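(* Let $(X,d,\mathfrak m)$ be a doubling, path connected, locally $\Lambda$-quasiconvex metric measure space, let $x,y\in X$ and $L\ge1$. Then $$\Lambda^{-1}\inf_{\Omega\in\mathrm{SS}_{\mathrm{top}}(x,y)}(\mathfrak m_{x,y}^L)^+(\Omega)\ \le\ \inf_{A\subseteq X\ \text{closed}}\mathrm{SR}_{x,y}(A)\ \le\ \inf_{\Omega\in\mathrm{SS}_{\mathrm{top}}(x,y)}(\mathfrak m_{x,y}^L)^+(\Omega).$$ In particular, if $(X,d)$ is path connected and locally geodesic, then $$\inf_{A\subseteq X\ \text{closed}}\mathrm{SR}_{x,y}(A)=\inf_{\Omega\in\mathrm{SS}_{\mathrm{top}}(x,y)}(\mathfrak m_{x,y}^L)^+(\Omega).$$
   Context: A metric measure space $(X,d,\mathfrak m)$ is a complete separable metric space $(X,d)$ with a nonnegative Borel measure $\mathfrak m$, finite on bounded sets and not identically zero. It is doubling if there is $C_D>0$ with $\mathfrak m(B_{2r}(z))\le C_D\,\mathfrak m(B_r(z))$ for all $z\in X$, $r>0$, where $B_r(z)$ is the open ball. For $\Lambda\ge 1$, $\Gamma_{x,y}^\Lambda$ is the set of continuous $\gamma\colon[0,1]\to X$ with $\gamma(0)=x$, $\gamma(1)=y$ that are $\Lambda d(x,y)$-Lipschitz, and $\Gamma_{x,y}=\bigcup_{\Lambda\ge1}\Gamma_{x,y}^\Lambda$. $X$ is locally $\Lambda$-quasiconvex (also called locally $\Lambda$-quasigeodesic) if for every $z\in X$ there is $r_z>0$ such that $\Gamma^\Lambda_{a,b}\ne\emptyset$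 for all $a,b\in B_{r_z}(z)$; locally geodesic means this with $\Lambda=1$. For Borel $A\subseteq X$ and $\gamma\in\Gamma_{x,y}$, $\ell(\gamma\cap A)=\int_0^1\chi_A(\gamma(t))|\dot\gamma(t)|\,dt$, with $|\dot\gamma|$ the metric speed, and $\mathrm{width}_{x,y}(A)=\inf_{\gamma\in\Gamma_{x,y}}\ell(\gamma\cap A)$ (with $\inf\emptyset=+\infty$). Riesz measure: $R_{x,y}(z)=\frac{d(x,z)}{\mathfrak m(B_{d(x,z)}(x))}+\frac{d(y,z)}{\mathfrak m(B_{d(y,z)}(y))}$ for $z\ne x,y$, and $R_{x,y}(x)=R_{x,y}(y)=0$. For $L\ge1$ let $B_{x,y}^L=B_{2Ld(x,y)}(x)\cup B_{2Ld(x,y)}(y)$, $R^L_{x,y}=\chi_{B^L_{x,y}}R_{x,y}$ and $\mathfrak m_{x,y}^L=R^L_{x,y}\,\mathfrak m$. The separating ratio is $\mathrm{SR}_{x,y}(A)=\frac{\mathfrak m_{x,y}^L(A)}{\mathrm{width}_{x,y}(A)}$, with the conventions $\mathrm{SR}_{x,y}(A)=0$ if $\mathrm{width}_{x,y}(A)=+\infty$ and $\mathrm{SR}_{x,y}(A)=+\infty$ if $\mathrm{width}_{x,y}(A)=0$. $\mathrm{SS}_{\mathrm{top}}(x,y)$ is the class of closed sets $\Omega\subseteq X$ for which there is $r>0$ with $B_r(x)\subseteq \mathrm{int}(\Omega)$ and $B_r(y)\subseteq \Omega^c$. For a Borel measure $\mu$ and Borel $A$, the Minkowski content is $\mu^+(A)=\liminf_{r\to0}\frac{\mu(\overline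 B_r(A)\setminus A)}{r}$, $\overline B_r(A)=\{z: d(z,A)\le r\}$. *)

theory Defs
  imports "HOL-Analysis.Analysis"
begin

text \<open>
  The space \<open>(X, d)\<close> is a type \<open>'a\<close> of class \<open>polish_space\<close>: in the library this class
  asserts that the given metric \<open>dist\<close> is itself complete, and that its topology is
  second countable, which for metric spaces is the same as separable.
\<close>

definition metric_measure_space :: "'a::polish_space measure \<Rightarrow> bool" where
  "metric_measure_space m \<longleftrightarrow>
     sets m = sets borel \<and>
     (\<forall>B\<in>sets borel. bounded B \<longrightarrow> emeasure m B < \<infinity>) \<and>
     emeasure m UNIV \<noteq> 0"

definition doubling :: "'a::polish_space measure \<Rightarrow> bool" where
  "doubling m \<longleftrightarrow>
     (\<exists>C::real. C > 0 \<and>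
        (\<forall>z. \<forall>r>0. emeasure m (ball z (2 * r)) \<le> ennreal C * emeasure m (ball z r)))"

text \<open>
  Curves are total functions on the reals of which only the restriction to \<open>[0, 1]\<close> matters.
\<close>

definition curves_const :: "real \<Rightarrow> 'a::polish_space \<Rightarrow> 'a \<Rightarrow> (real \<Rightarrow> 'a) set" where
  "curves_const \<Lambda> x y =
     {\<gamma>. continuous_on {0..1} \<gamma> \<and> \<gamma> 0 = x \<and> \<gamma> 1 = y \<and>
         (\<Lambda> * dist x y)-lipschitz_on {0..1} \<gamma>}"

definition curves :: "'a::polish_space \<Rightarrow> 'a \<Rightarrow> (real \<Rightarrow> 'a) set" where
  "curves x y = (\<Union>\<Lambda>\<in>{1..}. curves_const \<Lambda> x y)"

definition locally_quasiconvex :: "real \<Rightarrow> 'a::polish_space itself \<Rightarrow> bool" where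
  "locally_quasiconvex \<Lambda> (_ :: 'a itself) \<longleftrightarrow>
     (\<forall>z::'a. \<exists>r>0. \<forall>a\<in>ball z r. \<forall>b\<in>ball z r. curves_const \<Lambda> a b \<noteq> {})"

definition locally_geodesic :: "'a::polish_space itself \<Rightarrow> bool" where
  "locally_geodesic T \<longleftrightarrow> locally_quasiconvex 1 T"

text \<open>
  For a Lipschitz curve the limit defining the metric speed exists at almost every \<open>t\<close>. Where it
  does not exist, \<^const>\<open>Lim\<close> returns an unspecified value; this only happens on a null set,
  so it does not affect the integral in \<open>length_in\<close>.
\<close>

definition metric_speed :: "(real \<Rightarrow> 'a::polish_space) \<Rightarrow> real \<Rightarrow> real" where
  "metric_speed \<gamma> t = Lim (at t within {0..1}) (\<lambda>s. dist (\<gamma> s) (\<gamma> t) / \<bar>s - t\<bar>)"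

definition length_in :: "(real \<Rightarrow> 'a::polish_space) \<Rightarrow> 'a set \<Rightarrow> ennreal" where
  "length_in \<gamma> A =
     (\<integral>\<^sup>+ t\<in>{0..1}. indicator A (\<gamma> t) * ennreal (metric_speed \<gamma> t) \<partial>lborel)"

definition width :: "'a::polish_space \<Rightarrow> 'a \<Rightarrow> 'a set \<Rightarrow> ennreal" where
  "width x y A = (INF \<gamma>\<in>curves x y. length_in \<gamma> A)"

text \<open>
  Both quotients are taken in \<^typ>\<open>ennreal\<close>; in a doubling space all balls of positive radius
  have positive measure, so no division by zero occurs.
\<close>

definition riesz_kernel :: "'a::polish_space measure \<Rightarrow> 'a \<Rightarrow> 'a \<Rightarrow> 'a \<Rightarrow> ennreal" where
  "riesz_kernel m x y z =
     (if z = x \<or> z = y then 0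
      else ennreal (dist x z) / emeasure m (ball x (dist x z)) +
           ennreal (dist y z) / emeasure m (ball y (dist y z)))"

definition riesz_region :: "real \<Rightarrow> 'a::polish_space \<Rightarrow> 'a \<Rightarrow> 'a set" where
  "riesz_region L x y = ball x (2 * L * dist x y) \<union> ball y (2 * L * dist x y)"

definition riesz_measure ::
  "'a::polish_space measure \<Rightarrow> real \<Rightarrow> 'a \<Rightarrow> 'a \<Rightarrow> 'a measure" where
  "riesz_measure m L x y =
     density m (\<lambda>z. indicator (riesz_region L x y) z * riesz_kernel m x y z)"

definition separating_ratio ::
  "'a::polish_space measure \<Rightarrow> real \<Rightarrow> 'a \<Rightarrow> 'a \<Rightarrow> 'a set \<Rightarrow> ennreal" where
  "separating_ratio m L x y A =
     (if width x y A = \<infinity> then 0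
      else if width x y A = 0 then \<infinity>
      else emeasure (riesz_measure m L x y) A / width x y A)"

definition SS_top :: "'a::polish_space \<Rightarrow> 'a \<Rightarrow> 'a set set" where
  "SS_top x y =
     {\<Omega>. closed \<Omega> \<and> (\<exists>r>0. ball x r \<subseteq> interior \<Omega> \<and> ball y r \<subseteq> - \<Omega>)}"

text \<open>
  Nonemptiness is required explicitly because \<open>infdist z {} = 0\<close> in the library, whereas
  \<open>d(z, {}) = \<infinity>\<close> in the mathematics.
\<close>

definition closed_nbhd :: "real \<Rightarrow> 'a::polish_space set \<Rightarrow> 'a set" where
  "closed_nbhd r A = {z. A \<noteq> {} \<and> infdist z A \<le> r}"

definition minkowski_content :: "'a::polish_space measure \<Rightarrow> 'a set \<Rightarrow> ennreal" where
  "minkowski_content \<mu> A =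
     Liminf (at_right 0) (\<lambda>r::real. emeasure \<mu> (closed_nbhd r A - A) / ennreal r)"

end

theory Submission
  imports Defs
begin

text \<open>
  Let \<open>\<mu>\<close> be the truncated Riesz measure.

  For the upper bound, a separating closed set \<open>\<Omega>\<close> with Minkowski content \<open>c\<close> is surrounded by shells
  \<open>{z. 0 < infdist z \<Omega> \<le> r}\<close> of \<open>\<mu>\<close>-measure about \<open>c r\<close>, and every curve from \<open>x\<close> to \<open>y\<close> has to
  cross such a shell, on a length of at least \<open>r\<close>. So thin shells have separating ratio at most about \<open>c\<close>
  (\<open>INF_separating_ratio_le_minkowski_content\<close>).

  For the lower bound, let \<open>A\<close> be closed and let \<open>u z\<close> be the width of \<open>A\<close> between \<open>x\<close> and \<open>z\<close>. This
  function vanishes at \<open>x\<close>, equals the width \<open>W\<close> at \<open>y\<close>, is locally \<open>\<Lambda>\<close>-Lipschitz by local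
  quasiconvexity, and is locally constant outside \<open>A\<close>. Its sublevel sets \<open>{u \<le> t}\<close> with \<open>0 < t < W\<close>
  separate \<open>x\<close> from \<open>y\<close>. Their closed \<open>h\<close>-neighbourhoods are contained in \<open>{u \<le> t + \<Lambda> h}\<close>, at least for
  small \<open>h\<close> and near the support of \<open>\<mu>\<close>, which is compact because a complete doubling space is proper.
  Integrating the measures of the strips \<open>{t < u \<le> t + \<Lambda> h}\<close> over \<open>t\<close> gives at most \<open>\<Lambda> h\<close> times the
  mass that \<open>u\<close> sees, which is that of \<open>A\<close>, since \<open>u\<close> has only countably many values elsewhere. So the
  infimum of the contents of the sublevel sets is at most \<open>\<Lambda> \<mu>(A) / W\<close> (\<open>coarea_inequality\<close>,
  \<open>minkowski_content_le_strip\<close>). This uses that \<open>\<mu>\<close> is finite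
  (\<open>emeasure_riesz_measure_finite\<close>).

  Both halves compute with lengths of Lipschitz curves, which are integrals of the metric speed. That
  the metric speed exists almost everywhere (\<open>metric_derivative_ex\<close>) follows from the almost
  everywhere differentiability of real Lipschitz functions, which is derived from Vitali's covering
  theorem and the Radon-Nikodym theorem.
\<close>

section \<open>Differentiation of real Lipschitz functions\<close>

text \<open>
  The covering argument behind Lebesgue's differentiation theorem. If a difference quotient of \<open>G\<close>
  exceeds \<open>q\<close> over an interval, where \<open>q > p\<close>, then \<open>g \<ge> p\<close> holds on a fixed proportion of that
  interval. Disjoint such intervals inside an open \<open>U\<close> that hardly exceeds
  \<open>{g < p}\<close> therefore have small total length, and by Vitali's theorem they can be chosen to cover
  almost all of the bad set. The interval only has to contain the point, not to be centred at it: in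
  this way the one-sided difference quotients are controlled as well.
\<close>

lemma slope_excess_negligible:
  fixes g G :: "real \<Rightarrow> real"
  assumes g [measurable]: "g \<in> borel_measurable borel"
    and bound: "\<And>t. \<bar>g t\<bar> \<le> K"
    and G: "\<And>a b. a \<le> b \<Longrightarrow> G b - G a = (LINT t:{a..b}|lborel. g t)"
    and "p < q"
  shows "negligible {t. g t < p \<and> (\<forall>d>0. \<exists>a b. a < b \<and> b - a < d \<and> t \<in> {a..b} \<and>
            G b - G a > q * (b - a))}" (is "negligible ?E")
  unfolding negligible_outer_le
proof (intro allI impI)
  fix e :: real
  assume "e > 0"
  define S where "S = {t. g t < p}"
  have S [measurable]: "S \<in> sets borel"
    unfolding S_def by measurable
  \<comment> \<open>\<open>K'\<close> bounds \<open>g - p\<close>; the summand 1 makes it positive.\<close>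
  define K' where "K' = K + \<bar>p\<bar> + 1"
  have "K \<ge> 0"
    using bound[of 0] by linarith
  then have "K' > 0"
    unfolding K'_def by linarith
  define e' where "e' = (q - p) * e / K'"
  have "e' > 0"
    unfolding e'_def using \<open>e > 0\<close> \<open>p < q\<close> \<open>K' > 0\<close> by simp
  obtain U where U: "open U" "S \<subseteq> U" "emeasure lebesgue (U - S) < ennreal e'"
    using sets_lebesgue_outer_open[of S e'] \<open>e' > 0\<close> S by (metis sets_completionI_sets sets_lborel)
  have US: "emeasure lborel (U - S) < ennreal e'"
    using U by (simp add: emeasure_completion)
  \<comment> \<open>Only points outside \<open>S\<close> can push the mean of \<open>g\<close> above \<open>p\<close>, with an excess of at most \<open>K'\<close>.\<close>
  have interval: "ennreal ((q - p) * (b - a)) \<le> ennreal K' * emeasure lborel ({a..b} - S)"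
    if "a < b" and slope: "G b - G a > q * (b - a)" for a b
  proof -
    have "emeasure lborel ({a..b} - S) \<le> emeasure lborel {a..b}"
      by (rule emeasure_mono) auto
    also have "\<dots> < \<infinity>"
      by (simp add: emeasure_lborel_Icc_eq)
    finally have fin: "emeasure lborel ({a..b} - S) < \<infinity>" .
    have "(LINT t:{a..b}|lborel. g t) \<le> (LINT t:{a..b}|lborel. p + K' * indicator (- S) t)"
    proof (rule set_integral_mono)
      show "set_integrable lborel {a..b} g"
        unfolding set_integrable_def
        by (rule integrableI_bounded_set_indicator[where B=K])
             (use bound in \<open>auto simp: emeasure_lborel_Icc_eq\<close>)
      show "set_integrable lborel {a..b} (\<lambda>t. p + K' * indicator (- S) t)"
        unfolding set_integrable_def
        by (rule integrableI_bounded_set_indicator[where B="\<bar>p\<bar> + K'"])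
           (use \<open>K' > 0\<close> in \<open>auto simp: emeasure_lborel_Icc_eq indicator_def intro!: AE_I2\<close>)
      show "g t \<le> p + K' * indicator (- S) t" for t
        using bound[of t] by (auto simp: K'_def S_def indicator_def)
    qed
    also have "\<dots> = p * (b - a) + K' * measure lborel ({a..b} - S)"
    proof -
      have "(LINT t:{a..b}|lborel. p + K' * indicator (- S) t)
          = (LINT t|lborel. p * indicator {a..b} t + K' * indicator ({a..b} - S) t)"
        unfolding set_lebesgue_integral_def by (rule Bochner_Integration.integral_cong) (auto simp: indicator_def)
      also have "\<dots> = p * (b - a) + K' * measure lborel ({a..b} - S)"
        using fin \<open>a < b\<close> by (subst Bochner_Integration.integral_add) auto
      finally show ?thesis .
    qed
    finally have "(q - p) * (b - a) \<le> K' * measure lborel ({a..b} - S)"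
      using slope G[of a b] \<open>a < b\<close> by (simp add: algebra_simps)
    moreover have "emeasure lborel ({a..b} - S) = measure lborel ({a..b} - S)"
      using fin by (intro emeasure_eq_ennreal_measure) auto
    ultimately show ?thesis
      using \<open>K' > 0\<close> by (simp add: ennreal_mult'[symmetric] ennreal_leI)
  qed
  define \<I> where "\<I> = {(a, b). a < b \<and> {a..b} \<subseteq> U \<and> G b - G a > q * (b - a)}"
  define mid where "mid = (\<lambda>(a, b). (a + b) / 2 :: real)"
  define rad where "rad = (\<lambda>(a, b). (b - a) / 2 :: real)"
  have cball_eq: "cball (mid i) (rad i) = {fst i..snd i}" for i
    by (auto simp: mid_def rad_def dist_real_def field_simps abs_if split: prod.splits if_splits)
  obtain C where C: "countable C" "C \<subseteq> \<I>"
      "pairwise (\<lambda>i j. disjnt (cball (mid i) (rad i)) (cball (mid j) (rad j))) C"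
      "negligible (?E - (\<Union>i\<in>C. cball (mid i) (rad i)))"
  proof (rule Vitali_covering_theorem_cballs[of \<I> rad ?E mid])
    show "0 < rad i" if "i \<in> \<I>" for i
      using that by (auto simp: \<I>_def rad_def)
    fix t d :: real
    assume t: "t \<in> ?E" and "0 < d"
    then have "t \<in> U"
      using U(2) by (auto simp: S_def)
    then obtain \<delta> where \<delta>: "\<delta> > 0" "ball t \<delta> \<subseteq> U"
      using \<open>open U\<close> openE by blast
    obtain a b where ab: "a < b" "b - a < min d \<delta>" "t \<in> {a..b}" "G b - G a > q * (b - a)"
      using t \<open>0 < d\<close> \<open>\<delta> > 0\<close> by (auto dest!: spec[where x="min d \<delta>"])
    have "{a..b} \<subseteq> ball t \<delta>"
      using ab by (auto simp: dist_real_def)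
    then have "(a, b) \<in> \<I>"
      using ab \<delta> by (auto simp: \<I>_def)
    moreover have "rad (a, b) < d" "t \<in> cball (mid (a, b)) (rad (a, b))"
      using ab by (auto simp: cball_eq) (auto simp: rad_def)
    ultimately show "\<exists>i. i \<in> \<I> \<and> t \<in> cball (mid i) (rad i) \<and> rad i < d"
      by blast
  qed auto
  define I where "I = (\<lambda>i. {fst i..snd i} :: real set)"
  have disj: "disjoint_family_on I C"
    using C(3) by (auto simp: disjoint_family_on_def pairwise_def disjnt_def cball_eq I_def)
  have "ennreal (q - p) * emeasure lborel (\<Union>i\<in>C. I i)
      = (\<integral>\<^sup>+i. ennreal (q - p) * emeasure lborel (I i) \<partial>count_space C)"
    using C(1) disj by (subst emeasure_UN_countable) (auto simp: I_def nn_integral_cmult)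
  also have "\<dots> \<le> (\<integral>\<^sup>+i. ennreal K' * emeasure lborel (I i - S) \<partial>count_space C)"
  proof (rule nn_integral_mono)
    fix i assume "i \<in> space (count_space C)"
    then have "i \<in> \<I>" using C(2) by auto
    then show "ennreal (q - p) * emeasure lborel (I i) \<le> ennreal K' * emeasure lborel (I i - S)"
      using interval[of "fst i" "snd i"] \<open>p < q\<close>
      by (auto simp: \<I>_def I_def ennreal_mult'[symmetric])
  qed
  also have "\<dots> = ennreal K' * (\<integral>\<^sup>+i. emeasure lborel (I i - S) \<partial>count_space C)"
    by (simp add: nn_integral_cmult)
  also have "(\<integral>\<^sup>+i. emeasure lborel (I i - S) \<partial>count_space C) = emeasure lborel (\<Union>i\<in>C. I i - S)"
  proof (rule emeasure_UN_countable[symmetric])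
    show "disjoint_family_on (\<lambda>i. I i - S) C"
      using disj unfolding disjoint_family_on_def by blast
  qed (use C(1) in \<open>auto simp: I_def\<close>)
  also have "\<dots> \<le> emeasure lborel (U - S)"
  proof (rule emeasure_mono)
    have "I i \<subseteq> U" if "i \<in> C" for i
      using subsetD[OF C(2) that] by (auto simp: \<I>_def I_def)
    then show "(\<Union>i\<in>C. I i - S) \<subseteq> U - S"
      by blast
  qed (use \<open>open U\<close> in auto)
  also have "\<dots> \<le> ennreal e'"
    using US by simp
  finally have "ennreal (q - p) * emeasure lborel (\<Union>i\<in>C. I i) \<le> ennreal ((q - p) * e)"
    using \<open>K' > 0\<close> \<open>e' > 0\<close> by (simp add: ennreal_mult'[symmetric] e'_def mult_left_mono)
  then have le: "emeasure lborel (\<Union>i\<in>C. I i) \<le> ennreal e"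
    using \<open>p < q\<close> \<open>e > 0\<close> by (simp add: ennreal_mult' ennreal_mult_le_mult_iff)
  have UI [measurable]: "(\<Union>i\<in>C. I i) \<in> sets borel"
    using C(1) by (auto simp: I_def intro!: sets.countable_UN')
  define T where "T = (\<Union>i\<in>C. I i) \<union> (?E - (\<Union>i\<in>C. I i))"
  have neg: "?E - (\<Union>i\<in>C. I i) \<in> null_sets lebesgue"
    using C(4) by (simp add: cball_eq I_def negligible_iff_null_sets)
  have "emeasure lebesgue T = emeasure lebesgue (\<Union>i\<in>C. I i)"
    unfolding T_def by (rule emeasure_Un_null_set) (use neg UI in auto)
  also have "\<dots> \<le> ennreal e"
    using le by (simp add: emeasure_completion)
  finally have Te: "emeasure lebesgue T \<le> ennreal e" .
  have "T \<in> sets lebesgue"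
    unfolding T_def using null_setsD2[OF neg] UI by (intro sets.Un) (auto simp only: sets_completionI_sets sets_lborel)
  then have "T \<in> lmeasurable"
    using Te by (intro fmeasurableI) (auto intro: le_less_trans)
  moreover have "measure lebesgue T \<le> e"
    using Te \<open>e > 0\<close> by (simp add: measure_def enn2real_leI)
  moreover have "?E \<subseteq> T"
    by (auto simp: T_def)
  ultimately show "\<exists>T. ?E \<subseteq> T \<and> T \<in> lmeasurable \<and> measure lebesgue T \<le> e"
    by blast
qed


text \<open>
  A point avoids the exceptional sets of all rational pairs \<open>p < q\<close> for \<open>(g, G)\<close> and for
  \<open>(- g, - G)\<close> only if the difference quotients of \<open>G\<close> at that point have upper limit at most, and
  lower limit at least, the value of \<open>g\<close>.
\<close>

lemma AE_has_derivative_integral: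
  fixes g G :: "real \<Rightarrow> real"
  assumes g: "g \<in> borel_measurable borel"
    and bound: "\<And>t. \<bar>g t\<bar> \<le> K"
    and G: "\<And>a b. a \<le> b \<Longrightarrow> G b - G a = (LINT t:{a..b}|lborel. g t)"
  shows "AE t in lborel. (G has_real_derivative g t) (at t)"
proof -
  define bad where "bad = (\<lambda>(g :: real \<Rightarrow> real) G p q. {t. g t < p \<and> (\<forall>d>0. \<exists>a b. a < b \<and> b - a < d \<and>
      t \<in> {a..b} \<and> G b - G a > q * (b - a))})"
  have avoid: "AE t in lborel. t \<notin> N" if "negligible N" for N :: "real set"
    using that AE_not_in[of N lebesgue] by (simp add: negligible_iff_null_sets AE_completion_iff)
  have neg1: "negligible (bad g G p q)" if "p < q" for p q
    unfolding bad_def by (rule slope_excess_negligible[OF g bound G that])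
  have neg2: "negligible (bad (\<lambda>t. - g t) (\<lambda>t. - G t) p q)" if "p < q" for p q
    unfolding bad_def
  proof (rule slope_excess_negligible[OF _ _ _ that, where K=K])
    show "- G b - - G a = (LINT t:{a..b}|lborel. - g t)" if "a \<le> b" for a b
      using G[OF that] by (simp add: set_lebesgue_integral_def)
  qed (use g bound in auto)
  have AE1: "AE t in lborel. \<forall>p\<in>\<rat>. \<forall>q\<in>\<rat>. p < q \<longrightarrow> t \<notin> bad g G p q"
    using avoid[OF neg1] by (intro AE_ball_countable' countable_rat) auto
  have AE2: "AE t in lborel. \<forall>p\<in>\<rat>. \<forall>q\<in>\<rat>. p < q \<longrightarrow> t \<notin> bad (\<lambda>t. - g t) (\<lambda>t. - G t) p q"
    using avoid[OF neg2] by (intro AE_ball_countable' countable_rat) auto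
  have slope_lt: "\<forall>\<^sub>F s in at t. (G s - G t) / (s - t) < c"
    if good: "\<forall>p\<in>\<rat>. \<forall>q\<in>\<rat>. p < q \<longrightarrow> t \<notin> bad g G p q" and "g t < c" for g G :: "real \<Rightarrow> real" and t c
  proof -
    obtain q where q: "q \<in> \<rat>" "g t < q" "q < c"
      using Rats_dense_in_real[OF \<open>g t < c\<close>] by blast
    obtain p where p: "p \<in> \<rat>" "g t < p" "p < q"
      using Rats_dense_in_real[OF q(2)] by blast
    have "t \<notin> bad g G p q"
      using good p q by blast
    then obtain d where d: "d > 0"
        "\<And>a b. a < b \<Longrightarrow> b - a < d \<Longrightarrow> t \<in> {a..b} \<Longrightarrow> G b - G a \<le> q * (b - a)"
      using p(2) unfolding bad_def mem_Collect_eq by (metis not_less)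
    have "(G s - G t) / (s - t) \<le> q" if "s \<noteq> t" "dist s t < d" for s
    proof (cases "t < s")
      case True
      then show ?thesis
        using d(2)[of t s] that by (simp add: dist_real_def pos_divide_le_eq)
    next
      case False
      then have "G t - G s \<le> q * (t - s)"
        using d(2)[of s t] that by (simp add: dist_real_def)
      moreover have "(G s - G t) / (s - t) = (G t - G s) / (t - s)"
        by (metis minus_diff_eq minus_divide_divide)
      ultimately show ?thesis
        using False that by (simp add: pos_divide_le_eq)
    qed
    then show ?thesis
      unfolding eventually_at using d(1) q(3) by (intro exI[of _ d]) (auto intro: le_less_trans)
  qed
  show ?thesis
    using AE1 AE2
  proof eventually_elim
    case (elim t)
    have "((\<lambda>s. (G s - G t) / (s - t)) \<longlongrightarrow> g t) (at t)"
    proof (rule order_tendstoI)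
      fix c assume "g t < c"
      then show "\<forall>\<^sub>F s in at t. (G s - G t) / (s - t) < c"
        using slope_lt elim(1) by blast
    next
      fix c assume "c < g t"
      then have "\<forall>\<^sub>F s in at t. (- G s - - G t) / (s - t) < - c"
        by (intro slope_lt[OF elim(2)]) simp
      moreover have "(- G s - - G t) / (s - t) = - ((G s - G t) / (s - t))" for s
        by (simp add: minus_divide_left)
      ultimately show "\<forall>\<^sub>F s in at t. c < (G s - G t) / (s - t)"
        by simp
    qed
    then show ?case
      by (simp add: has_field_derivative_iff)
  qed
qed

text \<open>
  Both \<open>K t + f t\<close> and \<open>K t - f t\<close> are nondecreasing, and their Stieltjes measures add up to
  \<open>2 K\<close> times Lebesgue measure. The first one is therefore absolutely continuous with a density
  between \<open>0\<close> and \<open>2 K\<close>, and subtracting \<open>K\<close> from this density leaves a density for \<open>f\<close>. Together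
  with \<open>AE_has_derivative_integral\<close> this yields Rademacher's theorem and the fundamental theorem of
  calculus for Lipschitz functions of one variable.
\<close>

lemma Lipschitz_density:
  fixes f :: "real \<Rightarrow> real"
  assumes lip: "\<And>s t. \<bar>f s - f t\<bar> \<le> K * \<bar>s - t\<bar>"
  obtains g where "g \<in> borel_measurable borel" "\<And>t. \<bar>g t\<bar> \<le> K"
    "\<And>a b. a \<le> b \<Longrightarrow> f b - f a = (LINT t:{a..b}|lborel. g t)"
proof -
  have "K \<ge> 0"
    using lip[of 0 1] by simp
  have "K-lipschitz_on UNIV f"
    using lip \<open>K \<ge> 0\<close> by (auto simp: lipschitz_on_def dist_real_def)
  then have contf: "continuous_on UNIV f"
    by (rule lipschitz_on_continuous_on)
  define F1 where "F1 = (\<lambda>t. K * t + f t)"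
  define F2 where "F2 = (\<lambda>t. K * t - f t)"
  have mono: "F1 s \<le> F1 t" "F2 s \<le> F2 t" if "s \<le> t" for s t
    using lip[of t s] that by (auto simp: F1_def F2_def abs_le_iff algebra_simps)
  have cont: "continuous_on UNIV F1" "continuous_on UNIV F2"
    unfolding F1_def F2_def by (intro continuous_intros contf)+
  then have rcont: "continuous (at_right a) F1" "continuous (at_right a) F2" for a
    by (auto simp: continuous_on_eq_continuous_within intro: continuous_within_subset)
  define \<mu>1 where "\<mu>1 = interval_measure F1"
  define \<mu>2 where "\<mu>2 = interval_measure F2"
  have sets_eq [simp, measurable_cong]: "sets \<mu>1 = sets borel" "sets \<mu>2 = sets borel"
    by (simp_all add: \<mu>1_def \<mu>2_def)
  \<comment> \<open>On bounded windows all measures are finite, so that complements can be handled by cancellation.\<close>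
  define J where "J = (\<lambda>n :: nat. {- real n<..real n})"
  have [measurable]: "J n \<in> sets borel" for n
    by (simp add: J_def)
  have Ioc: "\<mu>1 {a<..b} + \<mu>2 {a<..b} = ennreal (2 * K) * lborel {a<..b}" for a b
  proof (cases "a \<le> b")
    case True
    then have "\<mu>1 {a<..b} + \<mu>2 {a<..b} = ennreal (F1 b - F1 a) + ennreal (F2 b - F2 a)"
      using mono rcont by (simp add: \<mu>1_def \<mu>2_def emeasure_interval_measure_Ioc)
    also have "\<dots> = ennreal (2 * K * (b - a))"
      using mono[OF True] by (simp add: ennreal_plus[symmetric] F1_def F2_def algebra_simps del: ennreal_plus)
    finally show ?thesis
      using True \<open>K \<ge> 0\<close> by (simp add: ennreal_mult)
  qed simp
  have sum_eq: "\<forall>n. \<mu>1 (A \<inter> J n) + \<mu>2 (A \<inter> J n) = ennreal (2 * K) * lborel (A \<inter> J n)"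
    if "A \<in> sets borel" for A
  proof -
    let ?\<G> = "range (\<lambda>(a, b). {a<..b::real})"
    have gen: "sigma_sets UNIV ?\<G> = sets borel"
      by (subst borel_sigma_sets_Ioc) simp
    have "Int_stable ?\<G>"
      by (force simp: Int_stable_def Int_greaterThanAtMost)
    moreover have "?\<G> \<subseteq> Pow UNIV"
      by simp
    moreover have "A \<in> sigma_sets UNIV ?\<G>"
      using that gen by simp
    ultimately show ?thesis
    proof (induction rule: sigma_sets_induct_disjoint)
      case (basic A)
      then show ?case
        by (auto simp: J_def Int_greaterThanAtMost Ioc)
    next
      case (compl A)
      then have [measurable]: "A \<in> sets borel"
        by (simp add: gen)
      show ?case
      proof
        fix n
        let ?x = "A \<inter> J n" and ?y = "(UNIV - A) \<inter> J n"
        have split: "M ?x + M ?y = M (J n)" if "sets M = sets borel" for M :: "real measure"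
          using that by (subst plus_emeasure) (auto intro!: arg_cong[where f="emeasure M"])
        have "ennreal (2 * K) * lborel ?x + (\<mu>1 ?y + \<mu>2 ?y) = (\<mu>1 ?x + \<mu>1 ?y) + (\<mu>2 ?x + \<mu>2 ?y)"
          unfolding compl(2)[rule_format, of n, symmetric] by (simp only: add.assoc add.left_commute)
        also have "\<dots> = \<mu>1 (J n) + \<mu>2 (J n)"
          by (simp add: split)
        also have "\<dots> = ennreal (2 * K) * lborel (J n)"
          unfolding J_def by (rule Ioc)
        also have "\<dots> = ennreal (2 * K) * lborel ?x + ennreal (2 * K) * lborel ?y"
          by (simp add: split distrib_left[symmetric])
        finally have "ennreal (2 * K) * lborel ?x + (\<mu>1 ?y + \<mu>2 ?y)
            = ennreal (2 * K) * lborel ?x + ennreal (2 * K) * lborel ?y" .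
        moreover have "lborel ?x \<le> lborel (J n)"
          by (rule emeasure_mono) auto
        then have "lborel ?x < \<infinity>"
          by (rule le_less_trans) (simp add: J_def)
        then have "ennreal (2 * K) * lborel ?x \<noteq> top"
          by (auto simp: ennreal_mult_eq_top_iff)
        ultimately show "\<mu>1 ?y + \<mu>2 ?y = ennreal (2 * K) * lborel ?y"
          unfolding ennreal_add_left_cancel infinity_ennreal_def by blast
      qed
    next
      case (union A)
      then have A: "A i \<in> sets borel" for i
        by (auto simp: gen)
      have split: "M ((\<Union>i. A i) \<inter> J n) = (\<Sum>i. M (A i \<inter> J n))" if "sets M = sets borel" for n and M :: "real measure"
      proof -
        have "disjoint_family (\<lambda>i. A i \<inter> J n)"
          using union(1) by (auto simp: disjoint_family_on_def)
        then show ?thesis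
          using that A by (subst suminf_emeasure) (auto intro!: arg_cong[where f="emeasure M"])
      qed
      show ?case
        using union(3) by (simp add: split suminf_add)
    qed simp
  qed
  have le: "\<mu>1 (A \<inter> J n) \<le> ennreal (2 * K) * lborel (A \<inter> J n)" if "A \<in> sets borel" for A n
    using sum_eq[OF that] by (metis le_iff_add)
  have UNJ: "(\<Union>n. J n) = UNIV"
  proof -
    have "x \<in> J (nat \<lceil>\<bar>x\<bar> + 1\<rceil>)" for x
      unfolding J_def by (simp, linarith)
    then show ?thesis by blast
  qed
  have "absolutely_continuous lborel \<mu>1"
    unfolding absolutely_continuous_def
  proof
    fix N :: "real set"
    assume N: "N \<in> null_sets lborel"
    then have [measurable]: "N \<in> sets borel" by auto
    have "\<mu>1 (N \<inter> J n) = 0" for n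
      using le[of N n] N null_set_Int2[of N lborel "J n"] by (auto simp: null_sets_def)
    then have "\<mu>1 (\<Union>n. N \<inter> J n) = 0"
      by (intro emeasure_UN_eq_0) auto
    then show "N \<in> null_sets \<mu>1"
      using UNJ by (simp add: null_sets_def Int_UN_distrib[symmetric])
  qed
  then obtain h where h [measurable]: "h \<in> borel_measurable borel" and dens: "density lborel h = \<mu>1"
    using sigma_finite_measure.Radon_Nikodym[OF sigma_finite_lborel, of \<mu>1] by auto
  have h_int: "\<mu>1 A = (\<integral>\<^sup>+t. h t * indicator A t \<partial>lborel)" if "A \<in> sets borel" for A
    using that by (simp add: dens[symmetric] emeasure_density)
  define D where "D = {t. h t > ennreal (2 * K)}"
  have [measurable]: "D \<in> sets borel"
    unfolding D_def by measurable
  have "AE t in lborel. t \<in> J n \<longrightarrow> h t \<le> ennreal (2 * K)" for n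
  proof -
    let ?A = "D \<inter> J n"
    have "emeasure lborel ?A \<le> emeasure lborel (J n)"
      by (rule emeasure_mono) auto
    also have "\<dots> < \<infinity>"
      by (simp add: J_def)
    finally have fin: "ennreal (2 * K) * emeasure lborel ?A \<noteq> \<infinity>"
      by (auto simp: ennreal_mult_eq_top_iff)
    have "(\<integral>\<^sup>+t. (h t - ennreal (2 * K)) * indicator ?A t \<partial>lborel) + ennreal (2 * K) * emeasure lborel ?A
        = (\<integral>\<^sup>+t. (h t - ennreal (2 * K)) * indicator ?A t + ennreal (2 * K) * indicator ?A t \<partial>lborel)"
      by (subst nn_integral_add) (auto simp: nn_integral_cmult_indicator)
    also have "\<dots> = \<mu>1 ?A"
      by (subst h_int) (auto intro!: nn_integral_cong simp: indicator_def D_def diff_add_cancel_ennreal less_imp_le)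
    also have "\<dots> \<le> 0 + ennreal (2 * K) * emeasure lborel ?A"
      using le[of D n] by simp
    finally have "ennreal (2 * K) * emeasure lborel ?A
          + (\<integral>\<^sup>+t. (h t - ennreal (2 * K)) * indicator ?A t \<partial>lborel)
        \<le> ennreal (2 * K) * emeasure lborel ?A + 0"
      by (simp only: add.commute)
    then have "(\<integral>\<^sup>+t. (h t - ennreal (2 * K)) * indicator ?A t \<partial>lborel) = 0"
      using fin unfolding ennreal_add_left_cancel_le by simp
    then have "AE t in lborel. (h t - ennreal (2 * K)) * indicator ?A t = 0"
      by (subst (asm) nn_integral_0_iff_AE) auto
    then show ?thesis
      by eventually_elim (auto simp: D_def indicator_def diff_eq_0_iff_ennreal not_le split: if_splits)
  qed
  then have "AE t in lborel. \<forall>n. t \<in> J n \<longrightarrow> h t \<le> ennreal (2 * K)"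
    unfolding AE_all_countable by blast
  then have h_le: "AE t in lborel. h t \<le> ennreal (2 * K)"
    by eventually_elim (use UNJ in blast)
  define h' where "h' = (\<lambda>t. min (2 * K) (enn2real (h t)))"
  have h' [measurable]: "h' \<in> borel_measurable borel" "\<And>t. 0 \<le> h' t" "\<And>t. h' t \<le> 2 * K"
    using \<open>K \<ge> 0\<close> by (auto simp: h'_def)
  have h'_eq: "AE t in lborel. h t = ennreal (h' t)"
    using h_le
  proof eventually_elim
    case (elim t)
    then obtain r where "0 \<le> r" "h t = ennreal r"
      by (metis ennreal_cases ennreal_less_top linorder_not_le)
    then show ?case
      using elim \<open>K \<ge> 0\<close> by (simp add: h'_def min_def)
  qed
  show ?thesis
  proof (rule that[of "\<lambda>t. h' t - K"])
    show "\<bar>h' t - K\<bar> \<le> K" for t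
      using h'(2,3)[of t] by linarith
    fix a b :: real
    assume "a \<le> b"
    have int: "integrable lborel (\<lambda>t. indicator {a..b} t *\<^sub>R h' t)"
      by (rule integrableI_bounded_set_indicator[where B="2 * K"])
         (use h' \<open>K \<ge> 0\<close> in \<open>auto simp: emeasure_lborel_Icc_eq\<close>)
    have "ennreal (F1 b - F1 a) = \<mu>1 {a..b}"
      unfolding \<mu>1_def using \<open>a \<le> b\<close> mono cont by (intro emeasure_interval_measure_Icc[symmetric]) auto
    also have "\<dots> = (\<integral>\<^sup>+t. ennreal (indicator {a..b} t *\<^sub>R h' t) \<partial>lborel)"
      using h'_eq by (subst h_int) (auto intro!: nn_integral_cong_AE simp: indicator_def)
    also have "\<dots> = ennreal (LINT t:{a..b}|lborel. h' t)"
      unfolding set_lebesgue_integral_def using h'(2) by (intro nn_integral_eq_integral int) auto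
    finally have "F1 b - F1 a = (LINT t:{a..b}|lborel. h' t)"
      using mono[OF \<open>a \<le> b\<close>] h'(2)
      by (subst (asm) ennreal_inj) (auto simp: set_lebesgue_integral_def intro!: Bochner_Integration.integral_nonneg)
    moreover have "(LINT t:{a..b}|lborel. h' t - K) = (LINT t:{a..b}|lborel. h' t) - (LINT t:{a..b}|lborel. K)"
      using int by (intro set_integral_diff) (auto simp: set_integrable_def emeasure_lborel_Icc_eq)
    moreover have "(LINT t:{a..b}|lborel. K) = K * (b - a)"
      using \<open>a \<le> b\<close> by (simp add: set_lebesgue_integral_def)
    ultimately show "f b - f a = (LINT t:{a..b}|lborel. h' t - K)"
      by (simp add: F1_def algebra_simps)
  qed measurable
qed

section \<open>Existence of the metric speed\<close>

text \<open>
  For a dense sequence \<open>x n\<close>, the distance between two points of the curve is the supremum over \<open>n\<close>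
  of the increments of the real functions \<open>\<phi> n t = dist (\<gamma> t) (x n)\<close>. Let \<open>g n\<close> be the density of
  \<open>\<phi> n\<close>, and let \<open>M\<close> be the supremum of all \<open>\<bar>g n\<bar>\<close>. Each single \<open>\<phi> n\<close> bounds the speed from below by
  \<open>\<bar>g n\<bar>\<close>, and the distance between two points is at most the integral \<open>H\<close> of \<open>M\<close> between their
  parameters, which bounds the speed from above by \<open>M\<close>. So the speed exists and equals \<open>M\<close> wherever
  the countably many functions \<open>\<phi> n\<close> and \<open>H\<close> have their densities as derivatives.
\<close>

lemma metric_derivative_ex:
  fixes \<gamma> :: "real \<Rightarrow> 'a::polish_space"
  assumes lip: "\<And>s t. dist (\<gamma> s) (\<gamma> t) \<le> K * \<bar>s - t\<bar>"
  obtains v where "v \<in> borel_measurable borel" "\<And>t. 0 \<le> v t" "\<And>t. v t \<le> K"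
    "AE t in lborel. ((\<lambda>s. dist (\<gamma> s) (\<gamma> t) / \<bar>s - t\<bar>) \<longlongrightarrow> v t) (at t)"
proof -
  obtain D :: "'a set" where D: "countable D" "\<And>X. open X \<Longrightarrow> X \<noteq> {} \<Longrightarrow> \<exists>d\<in>D. d \<in> X"
    by (rule countable_dense_setE) blast
  then have "D \<noteq> {}"
    by (metis empty_iff open_UNIV UNIV_not_empty)
  define x where "x = from_nat_into D"
  have dense: "\<exists>n. dist (x n) z < e" if "e > 0" for z e
  proof -
    have "\<exists>d\<in>D. d \<in> ball z e"
      by (rule D(2)) (use that in auto)
    then obtain d where "d \<in> D" "d \<in> ball z e"
      by blast
    moreover have "range x = D"
      unfolding x_def using \<open>D \<noteq> {}\<close> D(1) by (rule range_from_nat_into)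
    ultimately show ?thesis
      by (metis dist_commute imageE mem_ball)
  qed
  define \<phi> where "\<phi> = (\<lambda>n t. dist (\<gamma> t) (x n))"
  have \<phi>_le: "\<bar>\<phi> n s - \<phi> n t\<bar> \<le> dist (\<gamma> s) (\<gamma> t)" for n s t
    unfolding \<phi>_def by (metis abs_dist_diff_le dist_commute)
  have "\<exists>g. g \<in> borel_measurable borel \<and> (\<forall>t. \<bar>g t\<bar> \<le> K) \<and>
      (\<forall>a b. a \<le> b \<longrightarrow> \<phi> n b - \<phi> n a = (LINT t:{a..b}|lborel. g t))" for n
  proof -
    have lip\<phi>: "\<bar>\<phi> n s - \<phi> n t\<bar> \<le> K * \<bar>s - t\<bar>" for s t
      using \<phi>_le lip order_trans by blast
    show ?thesis
      by (rule Lipschitz_density[of "\<phi> n" K, OF lip\<phi>]) blast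
  qed
  then obtain g where g [measurable]: "\<And>n. g n \<in> borel_measurable borel"
      and g_le: "\<And>n t. \<bar>g n t\<bar> \<le> K"
      and g_int: "\<And>n a b. a \<le> b \<Longrightarrow> \<phi> n b - \<phi> n a = (LINT t:{a..b}|lborel. g n t)"
    by metis
  define M where "M = (\<lambda>t. SUP n. \<bar>g n t\<bar>)"
  have bdd: "bdd_above (range (\<lambda>n. \<bar>g n t\<bar>))" for t
    using g_le by (intro bdd_aboveI[where M=K]) auto
  have M [measurable]: "M \<in> borel_measurable borel"
    unfolding M_def by (rule borel_measurable_cSUP) (use bdd in auto)
  have gM: "\<bar>g n t\<bar> \<le> M t" for n t
    unfolding M_def by (rule cSUP_upper[OF _ bdd]) simp
  have M0: "0 \<le> M t" for t
    using gM[of 0 t] by linarith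
  have MK: "M t \<le> K" for t
    unfolding M_def by (rule cSUP_least) (use g_le in auto)
  have integrable: "set_integrable lborel {a..b} f"
    if [measurable]: "f \<in> borel_measurable borel" and "\<And>t. \<bar>f t\<bar> \<le> K" for f :: "real \<Rightarrow> real" and a b
    unfolding set_integrable_def
    by (rule integrableI_bounded_set_indicator[where B=K]) (use that in \<open>auto simp: emeasure_lborel_Icc_eq\<close>)
  have MK': "\<bar>M t\<bar> \<le> K" for t
    using M0 MK by simp
  define H where "H = (\<lambda>t. LBINT u=0..ereal t. M u)"
  have H: "H b - H a = (LINT t:{a..b}|lborel. M t)" if "a \<le> b" for a b
  proof -
    have "(LBINT u=0..ereal a. M u) + (LBINT u=ereal a..ereal b. M u) = (LBINT u=0..ereal b. M u)"
    proof (rule interval_integral_sum)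
      have "set_integrable lborel {min 0 (min a b)..max 0 (max a b)} M"
        by (rule integrable) (use MK' in auto)
      then have "set_integrable lborel {min 0 (min a b)<..<max 0 (max a b)} M"
        by (rule set_integrable_subset) auto
      then show "interval_lebesgue_integrable lborel (min 0 (min (ereal a) (ereal b))) (max 0 (max (ereal a) (ereal b))) M"
        by (simp add: interval_lebesgue_integrable_def zero_ereal_def flip: ereal_min ereal_max)
    qed
    then show ?thesis
      using that by (simp add: H_def interval_integral_Icc)
  qed
  have dist_le: "dist (\<gamma> s) (\<gamma> t) \<le> H s - H t" if "t \<le> s" for s t
  proof -
    have *: "\<bar>\<phi> n s - \<phi> n t\<bar> \<le> H s - H t" for n
    proof -
      have "\<bar>LINT t:{t..s}|lborel. g n t\<bar> \<le> (LINT t:{t..s}|lborel. \<bar>g n t\<bar>)"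
        unfolding set_lebesgue_integral_def
        by (rule order_trans[OF integral_abs_bound]) (simp add: abs_mult)
      also have "\<dots> \<le> (LINT t:{t..s}|lborel. M t)"
        by (rule set_integral_mono) (use gM g_le MK' in \<open>auto intro!: integrable\<close>)
      finally show ?thesis
        using g_int[OF that] H[OF that] by simp
    qed
    show ?thesis
    proof (rule field_le_epsilon)
      fix e :: real assume "e > 0"
      then obtain n where n: "dist (x n) (\<gamma> t) < e / 2"
        using dense[of "e / 2"] by auto
      have "dist (\<gamma> s) (\<gamma> t) \<le> \<phi> n s + dist (x n) (\<gamma> t)"
        unfolding \<phi>_def by (rule dist_triangle)
      also have "\<dots> \<le> (\<phi> n s - \<phi> n t) + e"
        using n by (simp add: \<phi>_def dist_commute)
      also have "\<dots> \<le> H s - H t + e"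
        using *[of n] by simp
      finally show "dist (\<gamma> s) (\<gamma> t) \<le> H s - H t + e" .
    qed
  qed
  have dist_le': "dist (\<gamma> s) (\<gamma> t) \<le> \<bar>H s - H t\<bar>" for s t
    using dist_le[of s t] dist_le[of t s] by (cases "s \<le> t") (auto simp: dist_commute)
  have AE1: "AE t in lborel. \<forall>n. (\<phi> n has_real_derivative g n t) (at t)"
    unfolding AE_all_countable
    by (intro allI AE_has_derivative_integral[of "g _" K]) (use g_le g_int in auto)
  have AE2: "AE t in lborel. (H has_real_derivative M t) (at t)"
    by (intro AE_has_derivative_integral[of _ K]) (use MK' H in auto)
  have slope: "((\<lambda>s. \<bar>f s - f t\<bar> / \<bar>s - t\<bar>) \<longlongrightarrow> \<bar>d\<bar>) (at t)"
    if "(f has_real_derivative d) (at t)" for f :: "real \<Rightarrow> real" and d t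
    using tendsto_rabs[OF that[unfolded has_field_derivative_iff]] by (simp add: abs_divide)
  have "AE t in lborel. ((\<lambda>s. dist (\<gamma> s) (\<gamma> t) / \<bar>s - t\<bar>) \<longlongrightarrow> M t) (at t)"
    using AE1 AE2
  proof eventually_elim
    case (elim t)
    show ?case
    proof (rule order_tendstoI)
      fix c assume "c < M t"
      then obtain n where "c < \<bar>g n t\<bar>"
        unfolding M_def by (subst (asm) less_cSUP_iff[OF _ bdd]) auto
      then have "\<forall>\<^sub>F s in at t. c < \<bar>\<phi> n s - \<phi> n t\<bar> / \<bar>s - t\<bar>"
        using elim(1) by (intro order_tendstoD(1)[OF slope]) auto
      then show "\<forall>\<^sub>F s in at t. c < dist (\<gamma> s) (\<gamma> t) / \<bar>s - t\<bar>"
        by eventually_elim (rule less_le_trans, assumption, rule divide_right_mono[OF \<phi>_le], simp)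
    next
      fix c assume "M t < c"
      then have "\<forall>\<^sub>F s in at t. \<bar>H s - H t\<bar> / \<bar>s - t\<bar> < c"
        using M0 by (intro order_tendstoD(2)[OF slope[OF elim(2)]]) auto
      then show "\<forall>\<^sub>F s in at t. dist (\<gamma> s) (\<gamma> t) / \<bar>s - t\<bar> < c"
        by eventually_elim (rule le_less_trans, rule divide_right_mono[OF dist_le'], simp)
    qed
  qed
  with M M0 MK show ?thesis
    by (rule that)
qed

text \<open>
  Composing with the retraction of the line onto \<open>{0..1}\<close> turns a curve on the unit interval into one
  on the whole line with the same Lipschitz constant.
\<close>

definition clamp01 :: "real \<Rightarrow> real" where
  "clamp01 t = max 0 (min 1 t)"

lemma clamp01_in [simp]: "clamp01 t \<in> {0..1}"
  by (auto simp: clamp01_def)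

lemma clamp01_id [simp]: "t \<in> {0..1} \<Longrightarrow> clamp01 t = t"
  by (auto simp: clamp01_def)

lemma Lipschitz_clamp01:
  assumes "K-lipschitz_on {0..1} \<gamma>"
  shows "dist (\<gamma> (clamp01 s)) (\<gamma> (clamp01 t)) \<le> K * \<bar>s - t\<bar>"
proof -
  have "dist (\<gamma> (clamp01 s)) (\<gamma> (clamp01 t)) \<le> K * dist (clamp01 s) (clamp01 t)"
    by (rule lipschitz_onD[OF assms]) (rule clamp01_in)+
  also have "\<dots> \<le> K * \<bar>s - t\<bar>"
    using lipschitz_on_nonneg[OF assms] by (intro mult_left_mono) (auto simp: clamp01_def dist_real_def)
  finally show ?thesis .
qed

lemma continuous_on_clamp01:
  assumes "K-lipschitz_on {0..1} \<gamma>"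
  shows "continuous_on UNIV (\<gamma> \<circ> clamp01)"
proof (rule lipschitz_on_continuous_on)
  show "K-lipschitz_on UNIV (\<gamma> \<circ> clamp01)"
    using Lipschitz_clamp01[OF assms] lipschitz_on_nonneg[OF assms]
    by (auto simp: lipschitz_on_def dist_real_def)
qed

lemma at_within_01_nontrivial: "t \<in> {0..1} \<Longrightarrow> at t within {0..1::real} \<noteq> bot"
  by (simp add: trivial_limit_within islimpt_Icc)

lemma metric_speed_ex:
  fixes \<gamma> :: "real \<Rightarrow> 'a::polish_space"
  assumes "K-lipschitz_on {0..1} \<gamma>"
  obtains v where "v \<in> borel_measurable borel" "\<And>t. 0 \<le> v t" "\<And>t. v t \<le> K"
    "AE t in lborel. t \<in> {0..1} \<longrightarrow>
       ((\<lambda>s. dist (\<gamma> s) (\<gamma> t) / \<bar>s - t\<bar>) \<longlongrightarrow> v t) (at t within {0..1})"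
proof -
  obtain v where v: "v \<in> borel_measurable borel" "\<And>t. 0 \<le> v t" "\<And>t. v t \<le> K"
    and AE: "AE t in lborel. ((\<lambda>s. dist (\<gamma> (clamp01 s)) (\<gamma> (clamp01 t)) / \<bar>s - t\<bar>) \<longlongrightarrow> v t) (at t)"
    using metric_derivative_ex[OF Lipschitz_clamp01[OF assms]] by blast
  have "AE t in lborel. t \<in> {0..1} \<longrightarrow>
       ((\<lambda>s. dist (\<gamma> s) (\<gamma> t) / \<bar>s - t\<bar>) \<longlongrightarrow> v t) (at t within {0..1})"
    using AE
  proof eventually_elim
    case (elim t)
    show ?case
    proof
      assume t: "t \<in> {0..1}"
      have "((\<lambda>s. dist (\<gamma> (clamp01 s)) (\<gamma> (clamp01 t)) / \<bar>s - t\<bar>) \<longlongrightarrow> v t) (at t within {0..1})"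
        using elim by (rule tendsto_within_subset) simp
      then show "((\<lambda>s. dist (\<gamma> s) (\<gamma> t) / \<bar>s - t\<bar>) \<longlongrightarrow> v t) (at t within {0..1})"
        by (rule Lim_transform_eventually) (use t in \<open>auto simp: eventually_at_filter\<close>)
    qed
  qed
  with v show ?thesis by (rule that)
qed

lemma metric_speed_eq:
  assumes "((\<lambda>s. dist (\<gamma> s) (\<gamma> t) / \<bar>s - t\<bar>) \<longlongrightarrow> c) (at t within {0..1})" "t \<in> {0..1}"
  shows "metric_speed \<gamma> t = c"
  unfolding metric_speed_def using assms at_within_01_nontrivial by (intro tendsto_Lim) auto

section \<open>Length of a curve inside a set\<close>

lemma AE_metric_speed_eq:
  assumes "AE t in lborel. t \<in> {0..1} \<longrightarrow>
       ((\<lambda>s. dist (\<gamma> s) (\<gamma> t) / \<bar>s - t\<bar>) \<longlongrightarrow> v t) (at t within {0..1})"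
  shows "AE t in lborel. t \<in> {0..1} \<longrightarrow> metric_speed \<gamma> t = v t"
  using assms by eventually_elim (use metric_speed_eq in blast)

text \<open>
  Curve lengths are computed with a Borel version \<open>v\<close> of the metric speed, because \<^const>\<open>metric_speed\<close>
  is unspecified on a null set.
\<close>

lemma length_in_eq:
  assumes "AE t in lborel. t \<in> {0..1} \<longrightarrow>
       ((\<lambda>s. dist (\<gamma> s) (\<gamma> t) / \<bar>s - t\<bar>) \<longlongrightarrow> v t) (at t within {0..1})"
  shows "length_in \<gamma> A = (\<integral>\<^sup>+ t\<in>{0..1}. indicator A (\<gamma> t) * ennreal (v t) \<partial>lborel)"
  unfolding length_in_def
proof (rule nn_integral_cong_AE)
  show "AE t in lborel. indicator A (\<gamma> t) * ennreal (metric_speed \<gamma> t) * indicator {0..1} t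
      = indicator A (\<gamma> t) * ennreal (v t) * indicator {0..1} t"
    using AE_metric_speed_eq[OF assms] by eventually_elim (auto simp: indicator_def)
qed

lemma length_in_le_Lipschitz:
  fixes \<gamma> :: "real \<Rightarrow> 'a::polish_space"
  assumes "K-lipschitz_on {0..1} \<gamma>"
  shows "length_in \<gamma> A \<le> ennreal K"
proof -
  obtain v where v [measurable]: "v \<in> borel_measurable borel" and v0: "\<And>t. 0 \<le> v t" and vK: "\<And>t. v t \<le> K"
    and lim: "AE t in lborel. t \<in> {0..1} \<longrightarrow>
       ((\<lambda>s. dist (\<gamma> s) (\<gamma> t) / \<bar>s - t\<bar>) \<longlongrightarrow> v t) (at t within {0..1})"
    using metric_speed_ex[OF assms] by blast
  have "length_in \<gamma> A \<le> (\<integral>\<^sup>+ t. ennreal K * indicator {0..1} t \<partial>(lborel :: real measure))"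
    unfolding length_in_eq[OF lim]
    by (intro nn_integral_mono) (use vK in \<open>auto simp: indicator_def intro: ennreal_leI\<close>)
  also have "\<dots> = ennreal K"
    by (simp add: nn_integral_cmult_indicator)
  finally show ?thesis .
qed

lemma length_in_cong:
  assumes "\<And>t. t \<in> {0..1} \<Longrightarrow> \<gamma> t = \<eta> t"
  shows "length_in \<gamma> A = length_in \<eta> A"
proof -
  have "metric_speed \<gamma> t = metric_speed \<eta> t" if "t \<in> {0..1}" for t
    unfolding metric_speed_def Topological_Spaces.Lim_def
    by (intro arg_cong[where f=The] ext tendsto_cong)
       (use that assms in \<open>auto simp: eventually_at_filter\<close>)
  then show ?thesis
    unfolding length_in_def using assms by (intro nn_integral_cong) (auto simp: indicator_def)
qed

text \<open>
  The length of an arc is invariant under affine reparametrisation: the speed of the reparametrised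
  curve is \<open>c\<close> times the speed of the original one, and the substitution rule cancels the factor.
\<close>

lemma length_in_affine:
  fixes \<gamma> :: "real \<Rightarrow> 'a::polish_space"
  assumes lip: "K-lipschitz_on {0..1} \<gamma>" and A [measurable]: "A \<in> sets borel"
    and p: "0 \<le> p" "0 < c" "p + c \<le> 1"
  shows "length_in (\<lambda>s. \<gamma> (p + c * s)) A =
    (\<integral>\<^sup>+ t\<in>{p..p+c}. indicator A (\<gamma> t) * ennreal (metric_speed \<gamma> t) \<partial>lborel)"
proof -
  obtain v where v [measurable]: "v \<in> borel_measurable borel" and v0: "\<And>t. 0 \<le> v t" and vK: "\<And>t. v t \<le> K"
    and lim: "AE t in lborel. t \<in> {0..1} \<longrightarrow>
       ((\<lambda>s. dist (\<gamma> s) (\<gamma> t) / \<bar>s - t\<bar>) \<longlongrightarrow> v t) (at t within {0..1})"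
    using metric_speed_ex[OF lip] by blast
  have [measurable]: "\<gamma> \<circ> clamp01 \<in> borel_measurable borel"
    by (intro borel_measurable_continuous_onI continuous_on_clamp01[OF lip])
  define f where "f = (\<lambda>t. indicator A ((\<gamma> \<circ> clamp01) t) * ennreal (v t) * indicator {p..p+c} t)"
  have [measurable]: "f \<in> borel_measurable borel"
    unfolding f_def by measurable
  have sub: "p + c * s \<in> {0..1}" if "s \<in> {0..1}" for s
  proof -
    have "c * s \<le> c" "0 \<le> c * s"
      using p that by (auto simp: mult_left_le)
    then show ?thesis
      unfolding atLeastAtMost_iff using p by linarith
  qed
  have in_iff: "p + c * s \<in> {p..p+c} \<longleftrightarrow> s \<in> {0..1}" for s
    using p by (auto simp: zero_le_mult_iff mult_le_cancel_left1)
  \<comment> \<open>The exceptional null set is pulled back under the affine map, which again gives a null set.\<close>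
  obtain N where N: "N \<in> null_sets lborel" "\<And>t. t \<notin> N \<Longrightarrow> t \<in> {0..1} \<Longrightarrow>
       ((\<lambda>s. dist (\<gamma> s) (\<gamma> t) / \<bar>s - t\<bar>) \<longlongrightarrow> v t) (at t within {0..1})"
    using AE_E3[OF lim] by (auto simp: space_lborel)
  have "AE t in lborel. t \<notin> N"
    using N(1) by (rule AE_not_in)
  then have AEN: "AE s in lborel. p + c * s \<notin> N"
    using p N(1) by (intro AE_borel_affine) (auto simp: pred_def)
  have lim': "AE s in lborel. s \<in> {0..1} \<longrightarrow>
     ((\<lambda>s'. dist (\<gamma> (p + c * s')) (\<gamma> (p + c * s)) / \<bar>s' - s\<bar>) \<longlongrightarrow> c * v (p + c * s)) (at s within {0..1})"
    using AEN
  proof eventually_elim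
    case (elim s)
    show ?case
    proof
      assume s: "s \<in> {0..1}"
      have "filterlim (\<lambda>s'. p + c * s') (at (p + c * s) within {0..1}) (at s within {0..1})"
        unfolding filterlim_at
      proof
        show "((\<lambda>s'. p + c * s') \<longlongrightarrow> p + c * s) (at s within {0..1})"
          by (intro tendsto_intros)
        show "\<forall>\<^sub>F s' in at s within {0..1}. p + c * s' \<in> {0..1} \<and> p + c * s' \<noteq> p + c * s"
          using sub p by (auto simp: eventually_at_filter)
      qed
      from filterlim_compose[OF N(2)[OF elim sub[OF s]] this]
      have "((\<lambda>s'. c * (dist (\<gamma> (p + c * s')) (\<gamma> (p + c * s)) / \<bar>p + c * s' - (p + c * s)\<bar>)) \<longlongrightarrow> c * v (p + c * s))
          (at s within {0..1})"
        by (intro tendsto_intros)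
      moreover have "c * (d / \<bar>p + c * s' - (p + c * s)\<bar>) = d / \<bar>s' - s\<bar>" for d s'
      proof -
        have "\<bar>p + c * s' - (p + c * s)\<bar> = c * \<bar>s' - s\<bar>"
          using p by (simp add: abs_mult flip: right_diff_distrib)
        then show ?thesis using p by simp
      qed
      ultimately show "((\<lambda>s'. dist (\<gamma> (p + c * s')) (\<gamma> (p + c * s)) / \<bar>s' - s\<bar>) \<longlongrightarrow> c * v (p + c * s)) (at s within {0..1})"
        by simp
    qed
  qed
  have "(\<integral>\<^sup>+ t\<in>{p..p+c}. indicator A (\<gamma> t) * ennreal (metric_speed \<gamma> t) \<partial>lborel) = (\<integral>\<^sup>+ t. f t \<partial>lborel)"
  proof (rule nn_integral_cong_AE)
    show "AE t in lborel. indicator A (\<gamma> t) * ennreal (metric_speed \<gamma> t) * indicator {p..p+c} t = f t"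
      using AE_metric_speed_eq[OF lim]
      by eventually_elim (use p in \<open>auto simp: indicator_def f_def\<close>)
  qed
  also have "\<dots> = ennreal c * (\<integral>\<^sup>+ s. f (p + c * s) \<partial>lborel)"
    using p by (subst nn_integral_real_affine[of f c p]) auto
  also have "\<dots> = (\<integral>\<^sup>+ s. ennreal c * f (p + c * s) \<partial>lborel)"
    by (rule nn_integral_cmult[symmetric]) measurable
  also have "\<dots> = (\<integral>\<^sup>+ s\<in>{0..1}. indicator A (\<gamma> (p + c * s)) * ennreal (c * v (p + c * s)) \<partial>lborel)"
    using p v0 sub unfolding f_def
    by (intro nn_integral_cong) (auto simp: indicator_def in_iff ennreal_mult simp del: atLeastAtMost_iff)
  also have "\<dots> = length_in (\<lambda>s. \<gamma> (p + c * s)) A"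
    by (rule length_in_eq[OF lim', symmetric])
  finally show ?thesis by simp
qed

lemma length_in_joinpaths_le:
  fixes \<gamma>1 \<gamma>2 :: "real \<Rightarrow> 'a::polish_space"
  assumes lip: "K-lipschitz_on {0..1} (\<gamma>1 +++ \<gamma>2)" and A: "A \<in> sets borel" and "\<gamma>1 1 = \<gamma>2 0"
  shows "length_in (\<gamma>1 +++ \<gamma>2) A \<le> length_in \<gamma>1 A + length_in \<gamma>2 A"
proof -
  let ?\<gamma> = "\<gamma>1 +++ \<gamma>2"
  let ?f = "\<lambda>t. indicator A (?\<gamma> t) * ennreal (metric_speed ?\<gamma> t)"
  obtain v where v [measurable]: "v \<in> borel_measurable borel" and v0: "\<And>t. 0 \<le> v t" and vK: "\<And>t. v t \<le> K"
    and lim: "AE t in lborel. t \<in> {0..1} \<longrightarrow>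
       ((\<lambda>s. dist (?\<gamma> s) (?\<gamma> t) / \<bar>s - t\<bar>) \<longlongrightarrow> v t) (at t within {0..1})"
    using metric_speed_ex[OF lip] by blast
  have [measurable]: "?\<gamma> \<circ> clamp01 \<in> borel_measurable borel"
    by (intro borel_measurable_continuous_onI continuous_on_clamp01[OF lip])
  define h where "h = (\<lambda>t. indicator A ((?\<gamma> \<circ> clamp01) t) * ennreal (v t))"
  have [measurable]: "h \<in> borel_measurable borel"
    unfolding h_def using A by measurable
  have f_eq: "(\<integral>\<^sup>+ t\<in>I. ?f t \<partial>lborel) = (\<integral>\<^sup>+ t\<in>I. h t \<partial>lborel)" if "I \<subseteq> {0..1}" for I
  proof (rule nn_integral_cong_AE)
    show "AE t in lborel. ?f t * indicator I t = h t * indicator I t"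
      using AE_metric_speed_eq[OF lim]
    proof eventually_elim
      case (elim t)
      then show ?case
        using that by (cases "t \<in> I") (auto simp: h_def subset_iff)
    qed
  qed
  have "length_in ?\<gamma> A = (\<integral>\<^sup>+ t\<in>{0..1}. h t \<partial>lborel)"
    unfolding length_in_def by (rule f_eq) simp
  also have "\<dots> \<le> (\<integral>\<^sup>+ t. h t * indicator {0..0 + 1/2} t + h t * indicator {1/2..1/2 + 1/2} t \<partial>lborel)"
    by (intro nn_integral_mono) (auto simp: indicator_def)
  also have "\<dots> = (\<integral>\<^sup>+ t\<in>{0..0 + 1/2}. h t \<partial>lborel) + (\<integral>\<^sup>+ t\<in>{1/2..1/2 + 1/2}. h t \<partial>lborel)"
    by (rule nn_integral_add) measurable
  also have "\<dots> = (\<integral>\<^sup>+ t\<in>{0..0 + 1/2}. ?f t \<partial>lborel) + (\<integral>\<^sup>+ t\<in>{1/2..1/2 + 1/2}. ?f t \<partial>lborel)"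
    by (subst (1 2) f_eq) auto
  also have "\<dots> = length_in (\<lambda>s. ?\<gamma> (0 + 1/2 * s)) A + length_in (\<lambda>s. ?\<gamma> (1/2 + 1/2 * s)) A"
    by (subst (1 2) length_in_affine[OF lip A]) auto
  also have "length_in (\<lambda>s. ?\<gamma> (0 + 1/2 * s)) A = length_in \<gamma>1 A"
    by (rule length_in_cong) (auto simp: joinpaths_def)
  also have "length_in (\<lambda>s. ?\<gamma> (1/2 + 1/2 * s)) A = length_in \<gamma>2 A"
    by (rule length_in_cong) (use \<open>\<gamma>1 1 = \<gamma>2 0\<close> in \<open>auto simp: joinpaths_def algebra_simps\<close>)
  finally show ?thesis .
qed

text \<open>
  Integrating the derivative of \<open>\<phi> \<circ> \<gamma>\<close> recovers the increment of \<open>\<phi>\<close> along the curve. This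
  derivative vanishes while the curve is outside \<open>A\<close>, and elsewhere it is at most the metric speed, as
  \<open>\<phi>\<close> does not increase distances.
\<close>

lemma length_in_ge:
  fixes \<gamma> :: "real \<Rightarrow> 'a::polish_space" and \<phi> :: "'a \<Rightarrow> real"
  assumes lip: "K-lipschitz_on {0..1} \<gamma>"
    and \<phi>: "\<And>a b. \<bar>\<phi> a - \<phi> b\<bar> \<le> dist a b"
    and const: "\<And>z. z \<notin> A \<Longrightarrow> \<forall>\<^sub>F w in nhds z. \<phi> w = \<phi> z"
  shows "ennreal (\<phi> (\<gamma> 1) - \<phi> (\<gamma> 0)) \<le> length_in \<gamma> A"
proof -
  obtain v where v [measurable]: "v \<in> borel_measurable borel" and v0: "\<And>t. 0 \<le> v t" and vK: "\<And>t. v t \<le> K"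
    and lim: "AE t in lborel. t \<in> {0..1} \<longrightarrow>
       ((\<lambda>s. dist (\<gamma> s) (\<gamma> t) / \<bar>s - t\<bar>) \<longlongrightarrow> v t) (at t within {0..1})"
    using metric_speed_ex[OF lip] by blast
  note cont = continuous_on_clamp01[OF lip]
  define f where "f = (\<lambda>t. \<phi> (\<gamma> (clamp01 t)))"
  have "\<bar>f s - f t\<bar> \<le> K * \<bar>s - t\<bar>" for s t
    unfolding f_def using \<phi> Lipschitz_clamp01[OF lip] order_trans by blast
  from Lipschitz_density[OF this] obtain g where g [measurable]: "g \<in> borel_measurable borel" and g_le: "\<And>t. \<bar>g t\<bar> \<le> K"
      and g_int: "\<And>a b. a \<le> b \<Longrightarrow> f b - f a = (LINT t:{a..b}|lborel. g t)"
    by blast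
  have deriv: "AE t in lborel. (f has_real_derivative g t) (at t)"
    by (rule AE_has_derivative_integral[OF g g_le g_int])
  have int: "integrable lborel (\<lambda>t. indicator {0..1} t *\<^sub>R \<bar>g t\<bar>)"
    by (rule integrableI_bounded_set_indicator[where B=K]) (use g_le in auto)
  have "f 1 - f 0 = (LINT t:{0..1}|lborel. g t)"
    by (rule g_int) simp
  also have "\<dots> \<le> (LINT t:{0..1}|lborel. \<bar>g t\<bar>)"
    unfolding set_lebesgue_integral_def
    by (rule order_trans[OF abs_ge_self order_trans[OF integral_abs_bound]]) (simp add: abs_mult)
  finally have "ennreal (f 1 - f 0) \<le> ennreal (LINT t:{0..1}|lborel. \<bar>g t\<bar>)"
    by (rule ennreal_leI)
  also have "\<dots> = (\<integral>\<^sup>+ t. ennreal (indicator {0..1} t *\<^sub>R \<bar>g t\<bar>) \<partial>lborel)"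
    unfolding set_lebesgue_integral_def by (intro nn_integral_eq_integral[symmetric] int) auto
  also have "\<dots> \<le> (\<integral>\<^sup>+ t\<in>{0..1}. indicator A (\<gamma> t) * ennreal (v t) \<partial>lborel)"
  proof (rule nn_integral_mono_AE)
    show "AE t in lborel. ennreal (indicator {0..1} t *\<^sub>R \<bar>g t\<bar>) \<le> indicator A (\<gamma> t) * ennreal (v t) * indicator {0..1} t"
      using lim deriv
    proof eventually_elim
      case (elim t)
      show ?case
      proof (cases "t \<in> {0..1}")
        case t: True
        show ?thesis
        proof (cases "\<gamma> t \<in> A")
          case True
          have "((\<lambda>s. \<bar>f s - f t\<bar> / \<bar>s - t\<bar>) \<longlongrightarrow> \<bar>g t\<bar>) (at t)"
            using tendsto_rabs[OF elim(2)[unfolded has_field_derivative_iff]] by (simp add: abs_divide)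
          then have 1: "((\<lambda>s. \<bar>f s - f t\<bar> / \<bar>s - t\<bar>) \<longlongrightarrow> \<bar>g t\<bar>) (at t within {0..1})"
            by (rule tendsto_within_subset) simp
          have "\<forall>\<^sub>F s in at t within {0..1}. \<bar>f s - f t\<bar> / \<bar>s - t\<bar> \<le> dist (\<gamma> s) (\<gamma> t) / \<bar>s - t\<bar>"
            unfolding eventually_at_filter f_def using t
            by (auto intro!: always_eventually divide_right_mono \<phi>)
          then have "\<bar>g t\<bar> \<le> v t"
            using elim(1) t by (intro tendsto_le[OF at_within_01_nontrivial _ 1]) auto
          then show ?thesis
            using t True by (simp add: ennreal_leI)
        next
          case False
          have "((\<gamma> \<circ> clamp01) \<longlongrightarrow> \<gamma> t) (nhds t)"
            using cont t by (metis UNIV_I clamp01_id comp_apply continuous_on_eq_continuous_at isCont_def open_UNIV tendsto_at_iff_tendsto_nhds)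
          then have "\<forall>\<^sub>F s in nhds t. \<phi> ((\<gamma> \<circ> clamp01) s) = \<phi> (\<gamma> t)"
            using const[OF False] unfolding filterlim_iff by blast
          then have "\<forall>\<^sub>F s in nhds t. f s = f t"
            using t by (simp add: f_def)
          moreover have "((\<lambda>_. f t) has_real_derivative 0) (at t)"
            by simp
          ultimately have "(f has_real_derivative 0) (at t)"
            by (subst DERIV_cong_ev) auto
          then have "g t = 0"
            using elim(2) DERIV_unique by blast
          then show ?thesis by simp
        qed
      qed simp
    qed
  qed
  also have "\<dots> = length_in \<gamma> A"
    by (rule length_in_eq[OF lim, symmetric])
  finally show ?thesis
    by (simp add: f_def)
qed

section \<open>The width as a function of its end point\<close>

lemma Lipschitz_joinpaths:
  fixes \<gamma>1 \<gamma>2 :: "real \<Rightarrow> 'a::metric_space"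
  assumes "K1-lipschitz_on {0..1} \<gamma>1" "K2-lipschitz_on {0..1} \<gamma>2" "\<gamma>1 1 = \<gamma>2 0"
  shows "(2 * max K1 K2)-lipschitz_on {0..1} (\<gamma>1 +++ \<gamma>2)"
  unfolding joinpaths_def
proof (rule lipschitz_on_concat)
  have "K1 \<ge> 0" "K2 \<ge> 0"
    using assms lipschitz_on_nonneg by blast+
  have "dist (\<gamma>1 (2 * s)) (\<gamma>1 (2 * t)) \<le> 2 * max K1 K2 * dist s t" if "s \<in> {0..1/2}" "t \<in> {0..1/2}" for s t
  proof -
    have "dist (\<gamma>1 (2 * s)) (\<gamma>1 (2 * t)) \<le> K1 * dist (2 * s) (2 * t)"
      by (rule lipschitz_onD[OF assms(1)]) (use that in auto)
    also have "\<dots> \<le> max K1 K2 * dist (2 * s) (2 * t)"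
      by (rule mult_right_mono) auto
    also have "dist (2 * s) (2 * t) = 2 * dist s t"
      by (auto simp: dist_real_def abs_if)
    finally show ?thesis by simp
  qed
  then show "(2 * max K1 K2)-lipschitz_on {0..1/2} (\<lambda>x. \<gamma>1 (2 * x))"
    using \<open>K1 \<ge> 0\<close> by (intro lipschitz_onI) auto
  have "dist (\<gamma>2 (2 * s - 1)) (\<gamma>2 (2 * t - 1)) \<le> 2 * max K1 K2 * dist s t" if "s \<in> {1/2..1}" "t \<in> {1/2..1}" for s t
  proof -
    have "dist (\<gamma>2 (2 * s - 1)) (\<gamma>2 (2 * t - 1)) \<le> K2 * dist (2 * s - 1) (2 * t - 1)"
      by (rule lipschitz_onD[OF assms(2)]) (use that in auto)
    also have "\<dots> \<le> max K1 K2 * dist (2 * s - 1) (2 * t - 1)"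
      by (rule mult_right_mono) auto
    also have "dist (2 * s - 1) (2 * t - 1) = 2 * dist s t"
      by (auto simp: dist_real_def abs_if)
    finally show ?thesis by simp
  qed
  then show "(2 * max K1 K2)-lipschitz_on {1/2..1} (\<lambda>x. \<gamma>2 (2 * x - 1))"
    using \<open>K1 \<ge> 0\<close> by (intro lipschitz_onI) auto
qed (use assms(3) in auto)

lemma curves_imp_Lipschitz:
  assumes "\<gamma> \<in> curves x y"
  obtains K where "K-lipschitz_on {0..1} \<gamma>" "\<gamma> 0 = x" "\<gamma> 1 = y"
  using assms by (auto simp: curves_def curves_const_def)

text \<open>
  For distinct end points the Lipschitz constant of a curve in \<^const>\<open>curves\<close> is arbitrary. For equal
  end points, in contrast, only the constant curve is left, whence the case distinction \<open>z = x\<close> in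
  \<open>width_le_add_length\<close> below.
\<close>

lemma Lipschitz_imp_curves:
  assumes "K-lipschitz_on {0..1} \<gamma>" "x \<noteq> y" "\<gamma> 0 = x" "\<gamma> 1 = y"
  shows "\<gamma> \<in> curves x y"
proof -
  define \<Lambda> where "\<Lambda> = max 1 (K / dist x y)"
  have "K \<le> \<Lambda> * dist x y"
    using assms(2) by (simp add: \<Lambda>_def flip: pos_divide_le_eq)
  then have "\<gamma> \<in> curves_const \<Lambda> x y"
    using assms lipschitz_on_continuous_on[OF assms(1)] lipschitz_on_le[OF assms(1)]
    by (simp add: curves_const_def)
  moreover have "\<Lambda> \<ge> 1"
    by (simp add: \<Lambda>_def)
  ultimately show ?thesis
    by (auto simp: curves_def)
qed

lemma width_self [simp]: "width x x A = 0"
proof -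
  have lip: "0-lipschitz_on {0..1} (\<lambda>_ :: real. x)"
    by (simp add: lipschitz_on_def)
  then have "(\<lambda>_. x) \<in> curves x x"
    by (force simp: curves_def curves_const_def)
  then have "width x x A \<le> length_in (\<lambda>_. x) A"
    unfolding width_def by (rule INF_lower)
  also have "\<dots> \<le> ennreal 0"
    by (rule length_in_le_Lipschitz[OF lip])
  finally show ?thesis by simp
qed

text \<open>
  Appending \<open>\<gamma>\<close> to an almost optimal curve from \<open>x\<close> to \<open>w\<close> gives a competitor for the width
  between \<open>x\<close> and \<open>z\<close>.
\<close>

lemma width_le_add_length:
  assumes \<gamma>: "\<gamma> \<in> curves w z" and A: "A \<in> sets borel"
  shows "width x z A \<le> width x w A + length_in \<gamma> A"
proof (cases "z = x")
  case False
  obtain K where K: "K-lipschitz_on {0..1} \<gamma>" "\<gamma> 0 = w" "\<gamma> 1 = z"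
    using \<gamma> by (rule curves_imp_Lipschitz)
  have "length_in \<gamma> A \<le> ennreal K"
    by (rule length_in_le_Lipschitz[OF K(1)])
  then have fin: "length_in \<gamma> A \<noteq> top"
    by (auto simp: top_unique)
  have "width x z A - length_in \<gamma> A \<le> width x w A"
    unfolding width_def[of x w]
  proof (rule INF_greatest)
    fix \<eta> assume "\<eta> \<in> curves x w"
    then obtain K' where K': "K'-lipschitz_on {0..1} \<eta>" "\<eta> 0 = x" "\<eta> 1 = w"
      by (rule curves_imp_Lipschitz)
    have lip: "(2 * max K' K)-lipschitz_on {0..1} (\<eta> +++ \<gamma>)"
      using K K' by (intro Lipschitz_joinpaths) auto
    have "\<eta> +++ \<gamma> \<in> curves x z"
      by (rule Lipschitz_imp_curves[OF lip]) (use False K K' in \<open>auto simp: joinpaths_def\<close>)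
    then have "width x z A \<le> length_in (\<eta> +++ \<gamma>) A"
      unfolding width_def by (rule INF_lower)
    also have "\<dots> \<le> length_in \<eta> A + length_in \<gamma> A"
      using K K' by (intro length_in_joinpaths_le[OF lip A]) auto
    finally show "width x z A - length_in \<gamma> A \<le> length_in \<eta> A"
      using fin by (simp add: ennreal_minus_le_iff add.commute)
  qed
  then show ?thesis
    using fin by (simp add: ennreal_minus_le_iff add.commute)
qed simp

lemma width_le_add_dist:
  assumes "\<gamma> \<in> curves_const \<Lambda> w z" "\<Lambda> \<ge> 1" and A: "A \<in> sets borel"
  shows "width x z A \<le> width x w A + ennreal (\<Lambda> * dist w z)"
proof -
  have "\<gamma> \<in> curves w z"
    using assms by (auto simp: curves_def)
  then have "width x z A \<le> width x w A + length_in \<gamma> A"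
    using A by (rule width_le_add_length)
  also have "length_in \<gamma> A \<le> ennreal (\<Lambda> * dist w z)"
    using assms(1) by (intro length_in_le_Lipschitz) (auto simp: curves_const_def)
  finally show ?thesis by simp
qed

lemma locally_quasiconvexE:
  fixes z :: "'a::polish_space"
  assumes "locally_quasiconvex \<Lambda> TYPE('a)"
  obtains r where "r > 0" "\<And>a b. a \<in> ball z r \<Longrightarrow> b \<in> ball z r \<Longrightarrow> \<exists>\<gamma>. \<gamma> \<in> curves_const \<Lambda> a b"
proof -
  obtain r where "r > 0" "\<forall>a\<in>ball z r. \<forall>b\<in>ball z r. curves_const \<Lambda> a b \<noteq> {}"
    using assms[unfolded locally_quasiconvex_def, rule_format, of z] by auto
  then show ?thesis
    by (intro that[of r]) (simp_all only: ex_in_conv simp_thms)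
qed

text \<open>
  By local quasiconvexity the points of finite width form a set that is open and closed, and \<open>x\<close>
  belongs to it. In particular any two points are joined by a Lipschitz curve.
\<close>

lemma width_finite:
  fixes x z :: "'a::polish_space"
  assumes qc: "locally_quasiconvex \<Lambda> TYPE('a)" and "\<Lambda> \<ge> 1"
    and conn: "connected (UNIV :: 'a set)" and A: "A \<in> sets borel"
  shows "width x z A < \<infinity>"
proof -
  define S where "S = {z. width x z A < \<infinity>}"
  have nbhd: "\<exists>r>0. \<forall>w\<in>ball z r. w \<in> S \<longleftrightarrow> z \<in> S" for z
  proof -
    obtain r where r: "r > 0" "\<And>a b. a \<in> ball z r \<Longrightarrow> b \<in> ball z r \<Longrightarrow> \<exists>\<gamma>. \<gamma> \<in> curves_const \<Lambda> a b"
      using locally_quasiconvexE[OF qc, of z] by blast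
    have "b \<in> S" if ab: "a \<in> S" "a \<in> ball z r" "b \<in> ball z r" for a b
    proof -
      obtain \<gamma> where "\<gamma> \<in> curves_const \<Lambda> a b"
        using r ab by blast
      then have "width x b A \<le> width x a A + ennreal (\<Lambda> * dist a b)"
        using \<open>\<Lambda> \<ge> 1\<close> A by (rule width_le_add_dist)
      also have "\<dots> < \<infinity>"
        using ab(1) by (simp add: S_def)
      finally show ?thesis by (simp add: S_def)
    qed
    then show ?thesis
      using r(1) by (intro exI[of _ r]) auto
  qed
  have "\<exists>r>0. ball z r \<subseteq> S" if "z \<in> S" for z
    using nbhd[of z] that by (meson subsetI)
  moreover have "\<exists>r>0. ball z r \<subseteq> - S" if "z \<in> - S" for z
    using nbhd[of z] that by (meson ComplD ComplI subsetI)
  ultimately have "open S" "open (- S)"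
    unfolding open_contains_ball by blast+
  then have "S = {} \<or> S = UNIV"
    using conn by (simp add: connected_clopen closed_def)
  moreover have "x \<in> S"
    by (simp add: S_def)
  ultimately have "z \<in> S"
    by blast
  then show ?thesis
    by (simp add: S_def)
qed

lemma length_in_avoiding:
  assumes "\<And>t. t \<in> {0..1} \<Longrightarrow> \<gamma> t \<notin> A"
  shows "length_in \<gamma> A = 0"
proof -
  have "length_in \<gamma> A = (\<integral>\<^sup>+ t. 0 \<partial>(lborel :: real measure))"
    unfolding length_in_def using assms by (intro nn_integral_cong) (auto simp: indicator_def)
  then show ?thesis by simp
qed

text \<open>
  Near a point \<open>z\<close> outside \<open>A\<close> any \<open>w\<close> is joined to \<open>z\<close>, in both directions, by a curve that is too
  short to reach \<open>A\<close>. Appending it to another curve costs no length in \<open>A\<close>.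
\<close>

lemma width_locally_const:
  fixes x z :: "'a::polish_space"
  assumes qc: "locally_quasiconvex \<Lambda> TYPE('a)" and "\<Lambda> \<ge> 1" and "closed A" "z \<notin> A"
  obtains r where "r > 0" "\<And>w. w \<in> ball z r \<Longrightarrow> width x w A = width x z A"
proof -
  obtain \<rho> where \<rho>: "\<rho> > 0" "ball z \<rho> \<subseteq> - A"
    using assms by (metis ComplI open_Compl openE)
  obtain r where r: "r > 0" "\<And>a b. a \<in> ball z r \<Longrightarrow> b \<in> ball z r \<Longrightarrow> \<exists>\<gamma>. \<gamma> \<in> curves_const \<Lambda> a b"
    using locally_quasiconvexE[OF qc, of z] by blast
  define r' where "r' = min r (\<rho> / \<Lambda>)"
  have A: "A \<in> sets borel"
    using assms by simp
  have le: "width x b A \<le> width x a A"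
    if ab: "a \<in> ball z r" "b \<in> ball z r" "\<Lambda> * dist a b < \<rho>" "a = z \<or> b = z" for a b
  proof -
    obtain \<gamma> where \<gamma>: "\<gamma> \<in> curves_const \<Lambda> a b"
      using r ab by blast
    then have lip: "(\<Lambda> * dist a b)-lipschitz_on {0..1} \<gamma>" and ends: "\<gamma> 0 = a" "\<gamma> 1 = b"
      by (auto simp: curves_const_def)
    have "\<gamma> t \<notin> A" if t: "t \<in> {0..1}" for t
    proof -
      have "dist (\<gamma> e) (\<gamma> t) < \<rho>" if "e = 0 \<or> e = 1" for e
      proof -
        have "dist (\<gamma> e) (\<gamma> t) \<le> \<Lambda> * dist a b * dist e t"
          using t that by (intro lipschitz_onD[OF lip]) auto
        also have "\<dots> \<le> \<Lambda> * dist a b * 1"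
          using t that \<open>\<Lambda> \<ge> 1\<close> by (intro mult_left_mono) (auto simp: dist_real_def)
        finally show ?thesis using ab by simp
      qed
      then have "\<gamma> t \<in> ball z \<rho>"
        using ends ab(4) by (metis mem_ball)
      then show ?thesis using \<rho> by auto
    qed
    then have "length_in \<gamma> A = 0"
      by (rule length_in_avoiding)
    moreover have "\<gamma> \<in> curves a b"
      using \<gamma> \<open>\<Lambda> \<ge> 1\<close> by (auto simp: curves_def)
    ultimately show ?thesis
      using width_le_add_length[of \<gamma> a b A x] A by simp
  qed
  show ?thesis
  proof (rule that[of r'])
    show "r' > 0"
      using r \<rho> \<open>\<Lambda> \<ge> 1\<close> by (simp add: r'_def)
    fix w assume "w \<in> ball z r'"
    then have "w \<in> ball z r" "dist z w < \<rho> / \<Lambda>"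
      by (auto simp: r'_def)
    then have "w \<in> ball z r" "\<Lambda> * dist z w < \<rho>" "\<Lambda> * dist w z < \<rho>"
      using \<open>\<Lambda> \<ge> 1\<close> by (simp_all add: pos_less_divide_eq mult.commute dist_commute)
    then show "width x w A = width x z A"
      using le[of z w] le[of w z] r(1) by (intro antisym) auto
  qed
qed

section \<open>Doubling spaces are proper\<close>

lemma metric_measure_space_sets: "metric_measure_space m \<Longrightarrow> sets m = sets borel"
  by (simp add: metric_measure_space_def)

lemma emeasure_ball_finite: "metric_measure_space m \<Longrightarrow> emeasure m (ball z r) < \<infinity>"
  unfolding metric_measure_space_def by (metis bounded_ball borel_open open_ball)

lemma doubling_iterate:
  assumes "\<And>z r. 0 < r \<Longrightarrow> emeasure m (ball z (2 * r)) \<le> ennreal C * emeasure m (ball z r)"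
    and "0 \<le> C" "0 < r"
  shows "emeasure m (ball z (2 ^ n * r)) \<le> ennreal (C ^ n) * emeasure m (ball z r)"
proof (induction n)
  case (Suc n)
  have "emeasure m (ball z (2 ^ Suc n * r)) \<le> ennreal C * emeasure m (ball z (2 ^ n * r))"
    using assms(1)[of "2 ^ n * r" z] \<open>0 < r\<close> by (simp add: mult.assoc)
  also have "\<dots> \<le> ennreal C * (ennreal (C ^ n) * emeasure m (ball z r))"
    by (intro mult_left_mono Suc) simp
  also have "\<dots> = ennreal (C ^ Suc n) * emeasure m (ball z r)"
    using \<open>0 \<le> C\<close> by (simp add: ennreal_mult' mult.assoc)
  finally show ?case .
qed simp

text \<open>
  If one ball were a null set, then by doubling so would be all concentric ones, and hence the space.
\<close>

lemma emeasure_ball_pos: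
  assumes m: "metric_measure_space m" and "doubling m" and "0 < r"
  shows "0 < emeasure m (ball z r)"
proof (rule ccontr)
  obtain C where C: "C > 0" "\<And>z r. 0 < r \<Longrightarrow> emeasure m (ball z (2 * r)) \<le> ennreal C * emeasure m (ball z r)"
    using \<open>doubling m\<close> unfolding doubling_def by auto
  assume "\<not> 0 < emeasure m (ball z r)"
  then have zero: "emeasure m (ball z (2 ^ n * r)) = 0" for n
    using doubling_iterate[OF C(2) less_imp_le[OF C(1)] \<open>0 < r\<close>, of z n] by (simp add: not_less)
  have "emeasure m (\<Union>n. ball z (2 ^ n * r)) = 0"
    by (rule emeasure_UN_eq_0[OF zero]) (simp add: image_subset_iff metric_measure_space_sets[OF m])
  moreover have "(\<Union>n. ball z (2 ^ n * r)) = UNIV"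
  proof -
    have "\<exists>n. dist z w < 2 ^ n * r" for w
      using real_arch_pow[of 2 "dist z w / r"] \<open>0 < r\<close> by (auto simp: pos_divide_less_eq)
    then show ?thesis by auto
  qed
  ultimately show False
    using m by (simp add: metric_measure_space_def)
qed

text \<open>
  The balls of radius \<open>e / 2\<close> around the points of an \<open>e\<close>-separated set are disjoint and lie in one
  fixed ball, and by doubling each of them carries a fixed fraction of the measure of that ball.
\<close>

lemma doubling_separated_card_le:
  fixes m :: "'a::polish_space measure" and z :: 'a
  assumes m: "metric_measure_space m" and dbl: "doubling m" and "0 < e"
  shows "\<exists>N. \<forall>T. finite T \<and> T \<subseteq> cball z R \<and> (\<forall>a\<in>T. \<forall>b\<in>T. a \<noteq> b \<longrightarrow> e \<le> dist a b)
      \<longrightarrow> card T \<le> N"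
proof -
  obtain C where C: "C > 0" "\<And>z r. 0 < r \<Longrightarrow> emeasure m (ball z (2 * r)) \<le> ennreal C * emeasure m (ball z r)"
    using dbl unfolding doubling_def by auto
  obtain n :: nat where n: "(2 * \<bar>R\<bar> + e) / (e / 2) < 2 ^ n"
    using real_arch_pow[of 2 "(2 * \<bar>R\<bar> + e) / (e / 2)"] by auto
  then have n': "2 * \<bar>R\<bar> + e < 2 ^ n * (e / 2)"
    using \<open>0 < e\<close> by (simp add: pos_divide_less_eq)
  let ?M = "emeasure m (ball z (\<bar>R\<bar> + e))"
  have M: "0 < ?M" "?M < \<infinity>"
    using emeasure_ball_pos[OF m dbl] emeasure_ball_finite[OF m] \<open>0 < e\<close> by auto
  show ?thesis
  proof (intro exI[of _ "nat \<lceil>C ^ n\<rceil>"] allI impI)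
    fix T assume "finite T \<and> T \<subseteq> cball z R \<and> (\<forall>a\<in>T. \<forall>b\<in>T. a \<noteq> b \<longrightarrow> e \<le> dist a b)"
    then have T: "finite T" "T \<subseteq> cball z R" "\<And>a b. a \<in> T \<Longrightarrow> b \<in> T \<Longrightarrow> a \<noteq> b \<Longrightarrow> e \<le> dist a b"
      by blast+
    have big: "?M \<le> ennreal (C ^ n) * emeasure m (ball t (e / 2))" if "t \<in> T" for t
    proof -
      have "ball z (\<bar>R\<bar> + e) \<subseteq> ball t (2 ^ n * (e / 2))"
      proof
        fix w assume "w \<in> ball z (\<bar>R\<bar> + e)"
        moreover have "dist t w \<le> dist z t + dist z w"
          by (metis dist_commute dist_triangle)
        moreover have "dist z t \<le> \<bar>R\<bar>"
          using T(2) that by auto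
        ultimately show "w \<in> ball t (2 ^ n * (e / 2))"
          using n' by simp
      qed
      then have "?M \<le> emeasure m (ball t (2 ^ n * (e / 2)))"
        by (rule emeasure_mono) (simp add: metric_measure_space_sets[OF m])
      also have "\<dots> \<le> ennreal (C ^ n) * emeasure m (ball t (e / 2))"
        using C \<open>0 < e\<close> by (intro doubling_iterate) auto
      finally show ?thesis .
    qed
    have disj: "disjoint_family_on (\<lambda>t. ball t (e / 2)) T"
      unfolding disjoint_family_on_def
    proof (intro ballI impI)
      fix a b assume ab: "a \<in> T" "b \<in> T" "a \<noteq> b"
      have False if "dist a w < e / 2" "dist b w < e / 2" for w
        using T(3)[OF ab] dist_triangle2[of a b w] that by linarith
      then show "ball a (e / 2) \<inter> ball b (e / 2) = {}"
        by auto
    qed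
    have "of_nat (card T) * ?M = (\<Sum>t\<in>T. ?M)"
      by simp
    also have "\<dots> \<le> (\<Sum>t\<in>T. ennreal (C ^ n) * emeasure m (ball t (e / 2)))"
      by (rule sum_mono[OF big])
    also have "\<dots> = ennreal (C ^ n) * (\<Sum>t\<in>T. emeasure m (ball t (e / 2)))"
      by (simp add: sum_distrib_left)
    also have "(\<Sum>t\<in>T. emeasure m (ball t (e / 2))) = emeasure m (\<Union>t\<in>T. ball t (e / 2))"
      using disj T(1) by (intro sum_emeasure) (auto simp: metric_measure_space_sets[OF m])
    also have "\<dots> \<le> ?M"
    proof (rule emeasure_mono)
      show "(\<Union>t\<in>T. ball t (e / 2)) \<subseteq> ball z (\<bar>R\<bar> + e)"
      proof (intro UN_least subsetI)
        fix t w assume "t \<in> T" "w \<in> ball t (e / 2)"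
        moreover from \<open>t \<in> T\<close> have "dist z t \<le> R"
          using T(2) by auto
        ultimately show "w \<in> ball z (\<bar>R\<bar> + e)"
          using dist_triangle[of z w t] \<open>0 < e\<close> by auto
      qed
    qed (simp add: metric_measure_space_sets[OF m])
    finally have "of_nat (card T) * ?M \<le> ennreal (C ^ n) * ?M"
      by (simp add: mult_left_mono)
    then have "ennreal (real (card T)) \<le> ennreal (C ^ n)"
      using M by (simp add: ennreal_of_nat_eq_real_of_nat mult.commute[of _ ?M] ennreal_mult_le_mult_iff)
    then have "real (card T) \<le> C ^ n"
      using C by (simp add: ennreal_le_iff)
    then show "card T \<le> nat \<lceil>C ^ n\<rceil>"
      by linarith
  qed
qed

text \<open>
  An \<open>e\<close>-separated set of maximal cardinality is an \<open>e\<close>-net, so that balls are totally bounded.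
\<close>

lemma doubling_imp_compact_cball:
  fixes m :: "'a::polish_space measure" and z :: 'a
  assumes m: "metric_measure_space m" and dbl: "doubling m"
  shows "compact (cball z R)"
  unfolding compact_eq_totally_bounded
proof (intro conjI allI impI)
  show "complete (cball z R)"
    by (simp add: complete_eq_closed)
  fix e :: real assume "0 < e"
  define P where "P = (\<lambda>T. finite T \<and> T \<subseteq> cball z R \<and> (\<forall>a\<in>T. \<forall>b\<in>T. a \<noteq> b \<longrightarrow> e \<le> dist a b))"
  obtain N where N: "\<forall>T. P T \<longrightarrow> card T \<le> N"
    using doubling_separated_card_le[OF m dbl \<open>0 < e\<close>, of z R] unfolding P_def by blast
  have "P {}"
    by (simp add: P_def)
  then obtain T where T: "P T" "\<And>T'. P T' \<Longrightarrow> card T' \<le> card T"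
    using ex_has_greatest_nat[of P "{}" card N] N by (auto simp: le_eq_less_or_eq)
  have "w \<in> (\<Union>t\<in>T. ball t e)" if "w \<in> cball z R" for w
  proof (rule ccontr)
    assume "w \<notin> (\<Union>t\<in>T. ball t e)"
    then have far: "e \<le> dist t w" if "t \<in> T" for t
      using that by (auto simp: not_less)
    then have "w \<notin> T"
      using \<open>0 < e\<close> by force
    have "P (insert w T)"
      using T(1) far \<open>w \<in> cball z R\<close> by (auto simp: P_def dist_commute)
    from T(2)[OF this] show False
      using T(1) \<open>w \<notin> T\<close> by (simp add: P_def)
  qed
  moreover have "finite T"
    using T(1) by (simp add: P_def)
  ultimately show "\<exists>k. finite k \<and> cball z R \<subseteq> (\<Union>x\<in>k. ball x e)"
    by (intro exI[of _ T] conjI subsetI)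
qed

section \<open>Finiteness of the Riesz measure\<close>

text \<open>
  One of the two summands of the Riesz kernel. At \<open>z = x\<close> it is \<open>0 / 0 = 0\<close>, which keeps it finite
  there.
\<close>

definition riesz_term :: "'a::polish_space measure \<Rightarrow> 'a \<Rightarrow> 'a \<Rightarrow> ennreal" where
  "riesz_term m x z = ennreal (dist x z) / emeasure m (ball x (dist x z))"

text \<open>
  The denominator is a nondecreasing, hence Borel, function of the radius.
\<close>

lemma riesz_term_measurable:
  assumes "metric_measure_space m"
  shows "riesz_term m x \<in> borel_measurable borel"
proof -
  define F where "F = (\<lambda>r. measure m (ball x r))"
  have F: "emeasure m (ball x r) = ennreal (F r)" for r
    unfolding F_def using emeasure_ball_finite[OF assms, of x r] by (intro emeasure_eq_ennreal_measure) simp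
  have "mono F"
    unfolding F_def
  proof (intro monoI measure_mono_fmeasurable)
    show "ball x s \<in> fmeasurable m" for s
      using emeasure_ball_finite[OF assms] by (intro fmeasurableI) (auto simp: metric_measure_space_sets[OF assms])
    then show "ball x s \<in> sets m" for s by auto
  qed auto
  then have [measurable]: "F \<in> borel_measurable borel"
    by (rule borel_measurable_mono)
  have [measurable]: "dist x \<in> borel_measurable borel"
    by (intro borel_measurable_continuous_onI continuous_intros)
  show ?thesis
    unfolding riesz_term_def F by measurable
qed

lemma riesz_kernel_eq: "riesz_kernel m x y z = (if z = x \<or> z = y then 0 else riesz_term m x z + riesz_term m y z)"
  by (simp add: riesz_kernel_def riesz_term_def)

text \<open>
  Split the ball into the dyadic annuli where \<open>dist x z\<close> lies between \<open>\<rho> k / 2\<close> and \<open>\<rho> k\<close>, with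
  \<open>\<rho> k = R / 2 ^ k\<close>. There the integrand is at most \<open>C \<rho> k\<close> divided by the measure of the ball of radius
  \<open>\<rho> k\<close>, by doubling. So the annulus contributes at most \<open>C \<rho> k\<close>, and these bounds form a geometric
  series.
\<close>

lemma riesz_term_integral_finite:
  assumes m: "metric_measure_space m" and dbl: "doubling m" and "0 < R"
  shows "(\<integral>\<^sup>+ z\<in>ball x R. riesz_term m x z \<partial>m) < \<infinity>"
proof -
  obtain C where C: "C > 0" "\<And>z r. 0 < r \<Longrightarrow> emeasure m (ball z (2 * r)) \<le> ennreal C * emeasure m (ball z r)"
    using dbl unfolding doubling_def by auto
  note [simp] = metric_measure_space_sets[OF m]
  define \<rho> where "\<rho> = (\<lambda>k :: nat. R * (1/2) ^ k)"
  have \<rho>: "\<rho> k > 0" "\<rho> (Suc k) = \<rho> k / 2" for k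
    using \<open>0 < R\<close> by (simp_all add: \<rho>_def)
  define V where "V = (\<lambda>k. emeasure m (ball x (\<rho> k)))"
  have V: "0 < V k" "V k < \<infinity>" for k
    unfolding V_def using emeasure_ball_pos[OF m dbl \<rho>(1)] emeasure_ball_finite[OF m] by auto
  have VC: "V k \<le> ennreal C * V (Suc k)" for k
    using C(2)[of "\<rho> (Suc k)" x] \<rho>(1)[of "Suc k"] by (simp add: V_def \<rho>(2))
  \<comment> \<open>A single summand, that of the annulus containing \<open>z\<close>, is enough for the bound.\<close>
  have ptw: "riesz_term m x z * indicator (ball x R) z
      \<le> (\<Sum>k. ennreal (C * \<rho> k) / V k * indicator (ball x (\<rho> k)) z)" for z
  proof (cases "z \<in> ball x R \<and> z \<noteq> x")
    case True
    let ?d = "dist x z"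
    have "0 < ?d" "?d < R"
      using True by auto
    have "\<exists>k. \<rho> (Suc k) \<le> ?d"
    proof -
      obtain k where "(1/2) ^ k < ?d / R"
        using real_arch_pow_inv[of "?d / R" "1/2"] \<open>0 < ?d\<close> \<open>0 < R\<close> by auto
      then have "\<rho> k < ?d"
        using \<open>0 < R\<close> by (simp add: \<rho>_def pos_less_divide_eq mult.commute)
      then show ?thesis
        using \<rho>[of k] by (intro exI[of _ k]) simp
    qed
    then have ex: "\<rho> (Suc (LEAST k. \<rho> (Suc k) \<le> ?d)) \<le> ?d"
      by (rule LeastI_ex)
    define k where "k = (LEAST k. \<rho> (Suc k) \<le> ?d)"
    have k: "\<rho> (Suc k) \<le> ?d"
      using ex by (simp add: k_def)
    have k': "?d < \<rho> k"
    proof (cases k)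
      case 0
      then show ?thesis using \<open>?d < R\<close> by (simp add: \<rho>_def)
    next
      case (Suc j)
      then have "\<not> \<rho> (Suc j) \<le> ?d"
        unfolding k_def by (intro not_less_Least) simp
      then show ?thesis using Suc by simp
    qed
    have "V (Suc k) \<le> emeasure m (ball x ?d)"
      unfolding V_def using k by (intro emeasure_mono) auto
    then have Vk: "V k \<le> ennreal C * emeasure m (ball x ?d)"
      using VC[of k] by (meson mult_left_mono order_trans zero_le)
    have *: "inverse (emeasure m (ball x ?d)) \<le> ennreal C / V k"
    proof -
      obtain v where v: "emeasure m (ball x ?d) = ennreal v" "0 < v"
        using emeasure_ball_pos[OF m dbl \<open>0 < ?d\<close>, of x] emeasure_ball_finite[OF m, of x ?d]
        by (cases "emeasure m (ball x ?d)") auto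
      obtain w where w: "V k = ennreal w" "0 < w"
        using V[of k] by (cases "V k") auto
      have "w \<le> C * v"
        using Vk C(1) v w by (simp add: ennreal_mult'[symmetric] ennreal_le_iff)
      then have "inverse v \<le> C / w"
        using v w by (simp add: field_simps)
      then show ?thesis
        using v w C(1) by (simp add: inverse_ennreal divide_ennreal ennreal_leI)
    qed
    have "riesz_term m x z \<le> ennreal (\<rho> k) * (ennreal C / V k)"
      unfolding riesz_term_def divide_ennreal_def
      using k' * by (intro mult_mono ennreal_leI) (auto simp: divide_ennreal_def)
    also have "\<dots> = ennreal (C * \<rho> k) / V k"
      using C(1) \<rho>(1)[of k] by (simp add: ennreal_times_divide ennreal_mult mult.commute)
    also have "\<dots> = ennreal (C * \<rho> k) / V k * indicator (ball x (\<rho> k)) z"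
      using k' by simp
    also have "\<dots> \<le> (\<Sum>k. ennreal (C * \<rho> k) / V k * indicator (ball x (\<rho> k)) z)"
    proof -
      have "f k \<le> suminf f" for f :: "nat \<Rightarrow> ennreal"
        using sum_le_suminf[of f "{k}"] by simp
      then show ?thesis .
    qed
    finally show ?thesis
      using True by simp
  qed (auto simp: riesz_term_def indicator_def)
  have "(\<integral>\<^sup>+ z\<in>ball x R. riesz_term m x z \<partial>m) \<le>
      (\<integral>\<^sup>+ z. (\<Sum>k. ennreal (C * \<rho> k) / V k * indicator (ball x (\<rho> k)) z) \<partial>m)"
    by (rule nn_integral_mono[OF ptw])
  also have "\<dots> = (\<Sum>k. \<integral>\<^sup>+ z. ennreal (C * \<rho> k) / V k * indicator (ball x (\<rho> k)) z \<partial>m)"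
  proof (rule nn_integral_suminf)
    have [measurable]: "ball x (\<rho> k) \<in> sets m" for k
      by simp
    show "(\<lambda>z. ennreal (C * \<rho> k) / V k * indicator (ball x (\<rho> k)) z) \<in> borel_measurable m" for k
      by measurable
  qed
  also have "\<dots> = (\<Sum>k. ennreal (C * \<rho> k))"
  proof (rule suminf_cong)
    fix k
    have "(\<integral>\<^sup>+ z. ennreal (C * \<rho> k) / V k * indicator (ball x (\<rho> k)) z \<partial>m) = ennreal (C * \<rho> k) / V k * V k"
      by (simp add: nn_integral_cmult_indicator V_def)
    also have "\<dots> = ennreal (C * \<rho> k)"
      using V[of k] by (simp add: ennreal_divide_times)
    finally show "(\<integral>\<^sup>+ z. ennreal (C * \<rho> k) / V k * indicator (ball x (\<rho> k)) z \<partial>m) = ennreal (C * \<rho> k)" .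
  qed
  also have "\<dots> = ennreal (\<Sum>k. C * \<rho> k)"
  proof (rule suminf_ennreal2)
    show "summable (\<lambda>k. C * \<rho> k)"
      unfolding \<rho>_def by (intro summable_mult summable_geometric) simp
    show "0 \<le> C * \<rho> k" for k
      using C(1) \<rho>(1)[of k] by simp
  qed
  also have "\<dots> < \<infinity>"
    by simp
  finally show ?thesis .
qed

lemma riesz_measure_sets [simp]:
  "metric_measure_space m \<Longrightarrow> sets (riesz_measure m L x y) = sets borel"
  by (simp add: riesz_measure_def metric_measure_space_sets)

lemma riesz_density_measurable:
  assumes m: "metric_measure_space m"
  shows "(\<lambda>z. indicator (riesz_region L x y) z * riesz_kernel m x y z) \<in> borel_measurable m"
proof -
  have [measurable]: "riesz_region L x y \<in> sets borel"
    by (simp add: riesz_region_def)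
  have [measurable]: "riesz_term m x \<in> borel_measurable borel" for x
    by (rule riesz_term_measurable[OF m])
  have "(\<lambda>z. indicator (riesz_region L x y) z * riesz_kernel m x y z) \<in> borel_measurable borel"
    unfolding riesz_kernel_eq by measurable
  then show ?thesis
    using measurable_cong_sets[OF metric_measure_space_sets[OF m] refl] by blast
qed

lemma emeasure_riesz_measure_off_region:
  assumes m: "metric_measure_space m"
  shows "emeasure (riesz_measure m L x y) (- riesz_region L x y) = 0"
proof -
  have "- riesz_region L x y \<in> sets m"
    by (simp add: riesz_region_def metric_measure_space_sets[OF m])
  then have "emeasure (riesz_measure m L x y) (- riesz_region L x y)
      = (\<integral>\<^sup>+ z. indicator (riesz_region L x y) z * riesz_kernel m x y z * indicator (- riesz_region L x y) z \<partial>m)"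
    unfolding riesz_measure_def by (intro emeasure_density riesz_density_measurable m)
  also have "\<dots> = (\<integral>\<^sup>+ z. 0 \<partial>m)"
    by (intro nn_integral_cong) (simp add: indicator_def)
  finally show ?thesis by simp
qed

lemma riesz_region_subset:
  assumes "L \<ge> 1"
  shows "riesz_region L x y \<subseteq> ball x ((2 * L + 1) * dist x y)" "riesz_region L x y \<subseteq> ball y ((2 * L + 1) * dist x y)"
proof -
  have *: "dist x z < (2 * L + 1) * dist x y" if "z \<in> riesz_region L x y" for x y z :: 'a
  proof -
    have "dist x z \<le> dist x y + dist y z"
      by (rule dist_triangle)
    then show ?thesis
      using that zero_le_dist[of x y] by (auto simp: riesz_region_def distrib_right simp del: zero_le_dist)
  qed
  show "riesz_region L x y \<subseteq> ball x ((2 * L + 1) * dist x y)"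
    using * by auto
  have "riesz_region L x y = riesz_region L y x"
    by (auto simp: riesz_region_def dist_commute)
  then show "riesz_region L x y \<subseteq> ball y ((2 * L + 1) * dist x y)"
    using *[of _ y x] by (auto simp: dist_commute)
qed

lemma emeasure_riesz_measure_finite:
  assumes m: "metric_measure_space m" and dbl: "doubling m" and "L \<ge> 1" "x \<noteq> y"
  shows "emeasure (riesz_measure m L x y) UNIV < \<infinity>"
proof -
  let ?R = "(2 * L + 1) * dist x y"
  have "?R > 0"
    using assms by simp
  note [simp] = metric_measure_space_sets[OF m]
  have [measurable]: "(\<lambda>z. riesz_term m x z * indicator (ball x ?R) z) \<in> borel_measurable m" for x
  proof (rule borel_measurable_times_ennreal)
    show "riesz_term m x \<in> borel_measurable m"
      using riesz_term_measurable[OF m] measurable_cong_sets[OF metric_measure_space_sets[OF m] refl] by blast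
  qed (simp add: borel_measurable_indicator)
  have "emeasure (riesz_measure m L x y) UNIV
      = (\<integral>\<^sup>+ z. indicator (riesz_region L x y) z * riesz_kernel m x y z * indicator UNIV z \<partial>m)"
    unfolding riesz_measure_def by (intro emeasure_density riesz_density_measurable m) simp
  also have "\<dots> \<le> (\<integral>\<^sup>+ z. riesz_term m x z * indicator (ball x ?R) z + riesz_term m y z * indicator (ball y ?R) z \<partial>m)"
    using riesz_region_subset[OF \<open>L \<ge> 1\<close>, of x y]
    by (intro nn_integral_mono) (auto simp: riesz_kernel_eq indicator_def subset_iff)
  also have "\<dots> = (\<integral>\<^sup>+ z\<in>ball x ?R. riesz_term m x z \<partial>m) + (\<integral>\<^sup>+ z\<in>ball y ?R. riesz_term m y z \<partial>m)"
    by (rule nn_integral_add) measurable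
  also have "\<dots> < \<infinity>"
    using riesz_term_integral_finite[OF m dbl \<open>?R > 0\<close>] by simp
  finally show ?thesis .
qed

section \<open>Upper bound by thin shells\<close>

text \<open>
  A closed set with small separating ratio is the shell \<open>\<epsilon> \<le> infdist z \<Omega> \<le> r\<close>. A curve from \<open>x\<close> to \<open>y\<close>
  starts in \<open>\<Omega>\<close> and ends at distance more than \<open>r\<close> from it, so that it spends length at least
  \<open>r - \<epsilon>\<close> in the shell, by \<open>length_in_ge\<close> for the truncated distance to \<open>\<Omega>\<close>. The lower cut-off \<open>\<epsilon>\<close>
  makes the shell closed and disjoint from \<open>\<Omega>\<close>; it tends to \<open>0\<close> at the end.
\<close>

lemma INF_separating_ratio_le_shell:
  fixes m :: "'a::polish_space measure"
  assumes m: "metric_measure_space m" and "closed \<Omega>" "x \<in> \<Omega>" and y: "ball y r' \<subseteq> - \<Omega>" and r: "0 < r" "r < r'"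
  shows "(INF A\<in>{A. closed A}. separating_ratio m L x y A)
    \<le> emeasure (riesz_measure m L x y) (closed_nbhd r \<Omega> - \<Omega>) / ennreal r"
proof -
  let ?\<mu> = "riesz_measure m L x y"
  let ?I = "INF A\<in>{A. closed A}. separating_ratio m L x y A"
  define M where "M = emeasure ?\<mu> (closed_nbhd r \<Omega> - \<Omega>)"
  note [simp] = riesz_measure_sets[OF m]
  have "\<Omega> \<noteq> {}"
    using \<open>x \<in> \<Omega>\<close> by auto
  have nbhd: "closed_nbhd r \<Omega> = {z. infdist z \<Omega> \<le> r}"
    using \<open>\<Omega> \<noteq> {}\<close> by (simp add: closed_nbhd_def)
  have cont: "continuous_on UNIV (\<lambda>z. infdist z \<Omega>)"
    by (intro continuous_intros)
  have infx: "infdist x \<Omega> = 0"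
    using \<open>x \<in> \<Omega>\<close> by simp
  have "r' \<le> infdist y \<Omega>"
    unfolding infdist_notempty[OF \<open>\<Omega> \<noteq> {}\<close>]
  proof (rule cINF_greatest[OF \<open>\<Omega> \<noteq> {}\<close>])
    show "r' \<le> dist y w" if "w \<in> \<Omega>" for w
      using y that by (force simp: subset_iff)
  qed
  then have infy: "r < infdist y \<Omega>"
    using r by simp
  have step: "?I \<le> M / ennreal (r - \<epsilon>)" if \<epsilon>: "0 < \<epsilon>" "\<epsilon> < r" for \<epsilon>
  proof -
    define A where "A = {z. \<epsilon> \<le> infdist z \<Omega> \<and> infdist z \<Omega> \<le> r}"
    have "closed A"
      unfolding A_def by (intro closed_Collect_conj closed_Collect_le cont continuous_intros)
    define \<phi> where "\<phi> = (\<lambda>z. max \<epsilon> (min r (infdist z \<Omega>)))"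
    have \<phi>_lip: "\<bar>\<phi> a - \<phi> b\<bar> \<le> dist a b" for a b
      using infdist_triangle[of a \<Omega> b] infdist_triangle[of b \<Omega> a] by (auto simp: \<phi>_def dist_commute)
    have \<phi>_const: "\<forall>\<^sub>F w in nhds z. \<phi> w = \<phi> z" if "z \<notin> A" for z
    proof -
      consider "infdist z \<Omega> < \<epsilon>" | "r < infdist z \<Omega>"
        using \<open>z \<notin> A\<close> by (auto simp: A_def)
      then show ?thesis
      proof cases
        case 1
        have "open {w. infdist w \<Omega> < \<epsilon>}"
          by (intro open_Collect_less cont continuous_intros)
        then have "\<forall>\<^sub>F w in nhds z. w \<in> {w. infdist w \<Omega> < \<epsilon>}"
          using 1 by (intro eventually_nhds_in_open) auto
        then show ?thesis
          by eventually_elim (use 1 \<epsilon> in \<open>auto simp: \<phi>_def\<close>)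
      next
        case 2
        have "open {w. r < infdist w \<Omega>}"
          by (intro open_Collect_less cont continuous_intros)
        then have "\<forall>\<^sub>F w in nhds z. w \<in> {w. r < infdist w \<Omega>}"
          using 2 by (intro eventually_nhds_in_open) auto
        then show ?thesis
          by eventually_elim (use 2 \<epsilon> in \<open>auto simp: \<phi>_def\<close>)
      qed
    qed
    have width: "ennreal (r - \<epsilon>) \<le> width x y A"
      unfolding width_def
    proof (rule INF_greatest)
      fix \<gamma> assume "\<gamma> \<in> curves x y"
      then obtain K where K: "K-lipschitz_on {0..1} \<gamma>" "\<gamma> 0 = x" "\<gamma> 1 = y"
        by (rule curves_imp_Lipschitz)
      have "ennreal (\<phi> (\<gamma> 1) - \<phi> (\<gamma> 0)) \<le> length_in \<gamma> A"
        by (rule length_in_ge[OF K(1) \<phi>_lip \<phi>_const])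
      then show "ennreal (r - \<epsilon>) \<le> length_in \<gamma> A"
        using K infx infy \<epsilon> by (simp add: \<phi>_def)
    qed
    have "A \<subseteq> closed_nbhd r \<Omega> - \<Omega>"
      using \<epsilon> by (auto simp: A_def nbhd)
    moreover have "closed {z. infdist z \<Omega> \<le> r}"
      by (intro closed_Collect_le cont continuous_intros)
    then have "closed_nbhd r \<Omega> - \<Omega> \<in> sets ?\<mu>"
      using \<open>closed \<Omega>\<close> unfolding nbhd by simp
    ultimately have AM: "emeasure ?\<mu> A \<le> M"
      unfolding M_def by (rule emeasure_mono)
    have "separating_ratio m L x y A \<le> M / ennreal (r - \<epsilon>)"
    proof (cases "width x y A = \<infinity>")
      case False
      have "0 < ennreal (r - \<epsilon>)"
        using \<epsilon> by simp
      then have pos: "0 < width x y A"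
        using width by (rule less_le_trans)
      have "emeasure ?\<mu> A / width x y A \<le> M / ennreal (r - \<epsilon>)"
      proof (rule divide_le_posI_ennreal[OF pos])
        have "emeasure ?\<mu> A \<le> ennreal (r - \<epsilon>) * (M / ennreal (r - \<epsilon>))"
          using AM \<epsilon> by (simp add: ennreal_times_divide mult.commute[of _ M] mult_divide_eq_ennreal)
        also have "\<dots> \<le> width x y A * (M / ennreal (r - \<epsilon>))"
          using width by (rule mult_right_mono) simp
        finally show "emeasure ?\<mu> A \<le> width x y A * (M / ennreal (r - \<epsilon>))" .
      qed
      then show ?thesis
        using False pos by (auto simp: separating_ratio_def)
    qed (simp add: separating_ratio_def)
    then show ?thesis
      using \<open>closed A\<close> by (intro INF_lower2[of A]) auto
  qed
  have "?I \<le> M / ennreal r"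
  proof (cases "M = \<infinity>")
    case True
    then show ?thesis
      by (simp add: ennreal_top_divide)
  next
    case False
    then obtain M' where M': "M = ennreal M'" "0 \<le> M'"
      by (cases M) auto
    have "?I \<le> ennreal (M' / (r / 2))"
      using step[of "r / 2"] r(1) M' by (simp add: divide_ennreal)
    then have "?I < top"
      by (rule le_less_trans) simp
    then obtain I' where I': "?I = ennreal I'" "0 \<le> I'"
      by (rule less_top_ennreal[THEN iffD1, THEN exE]) blast
    \<comment> \<open>The limit is taken along \<open>\<epsilon> = (1 - q) * r\<close> for \<open>q\<close> tending to \<open>1\<close>.\<close>
    have "q * (I' * r) \<le> M'" if "0 < q" "q < 1" for q
    proof -
      have "?I \<le> M / ennreal (r - (1 - q) * r)"
        using that r(1) by (intro step) (auto simp: algebra_simps)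
      then have "ennreal I' \<le> ennreal (M' / (q * r))"
        using that r(1) M' I' by (simp add: divide_ennreal algebra_simps)
      then have "I' \<le> M' / (q * r)"
        using that r(1) M' by (subst (asm) ennreal_le_iff) auto
      then show ?thesis
        using that r(1) by (simp add: pos_le_divide_eq mult_ac)
    qed
    then have "I' * r \<le> M'"
      by (rule field_le_mult_one_interval)
    then show ?thesis
      using I' M' r(1) by (simp add: divide_ennreal ennreal_leI pos_le_divide_eq)
  qed
  then show ?thesis
    by (simp add: M_def)
qed

lemma INF_separating_ratio_le_minkowski_content:
  fixes m :: "'a::polish_space measure"
  assumes m: "metric_measure_space m" and "\<Omega> \<in> SS_top x y"
  shows "(INF A\<in>{A. closed A}. separating_ratio m L x y A) \<le> minkowski_content (riesz_measure m L x y) \<Omega>"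
proof -
  obtain r' where \<Omega>: "closed \<Omega>" "r' > 0" "ball x r' \<subseteq> interior \<Omega>" "ball y r' \<subseteq> - \<Omega>"
    using assms(2) by (auto simp: SS_top_def)
  then have "x \<in> \<Omega>"
    using interior_subset by fastforce
  have "\<forall>\<^sub>F r in at_right 0. r \<in> {0<..<r'}"
    using \<open>r' > 0\<close> by (rule eventually_at_right_real)
  then show ?thesis
    unfolding minkowski_content_def
    by (intro Liminf_bounded) (auto elim!: eventually_mono intro!: INF_separating_ratio_le_shell[OF m \<Omega>(1) \<open>x \<in> \<Omega>\<close> \<Omega>(4)])
qed

section \<open>Lower bound by sublevel sets of the width\<close>

text \<open>
  For fixed \<open>n\<close>, Tonelli's theorem bounds the integral over \<open>t\<close> of the strip measures
  \<open>\<mu> {z. t < u z \<and> u z \<le> t + \<Lambda> / Suc n}\<close> by \<open>\<Lambda> / Suc n\<close> times the total mass, and Fatou's lemma passes to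
  the lower limit. To get the mass of \<open>A\<close> only, note that the values of \<open>u\<close> outside \<open>A\<close> lie in some
  sequence \<open>s\<close>, as \<open>u\<close> is locally constant there. For \<open>t\<close> different from the finitely many values \<open>s k\<close> with
  \<open>k < N\<close>, thin strips above \<open>t\<close> miss these level sets. So the parts of these level sets outside \<open>A\<close>
  can be discarded before integrating, which leaves the set \<open>B N\<close>; as \<open>N\<close> grows, these sets decrease
  to \<open>A\<close>. Finiteness of \<open>\<mu>\<close> makes their masses converge.
\<close>

lemma coarea_inequality:
  fixes \<mu> :: "'a::polish_space measure" and u :: "'a \<Rightarrow> real" and I :: ennreal
  assumes sets [simp]: "sets \<mu> = sets borel" and fin: "emeasure \<mu> UNIV < \<infinity>"
    and u: "continuous_on UNIV u" and A: "closed A"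
    and const: "\<And>z. z \<notin> A \<Longrightarrow> \<exists>r>0. \<forall>w\<in>ball z r. u w = u z"
    and "0 < \<Lambda>" "0 < W"
    and I: "\<And>t. 0 < t \<Longrightarrow> t < W \<Longrightarrow>
      I \<le> liminf (\<lambda>n. ennreal (real (Suc n)) * emeasure \<mu> {z. t < u z \<and> u z \<le> t + \<Lambda> / real (Suc n)})"
  shows "I * ennreal W \<le> ennreal \<Lambda> * emeasure \<mu> A"
proof -
  have [measurable]: "u \<in> borel_measurable borel"
    by (rule borel_measurable_continuous_onI[OF u])
  have [measurable]: "A \<in> sets borel"
    using A by simp
  have [measurable_cong]: "sets \<mu> = sets borel" by simp
  have space: "space \<mu> = UNIV"
    using sets_eq_imp_space_eq[OF sets] by simp
  interpret \<mu>: finite_measure \<mu>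
    by standard (use fin in \<open>simp add: space less_top\<close>)
  interpret pair_sigma_finite lborel \<mu> ..
  have "countable (u ` (- A))"
  proof -
    obtain \<B> :: "'a set set" where \<B>: "countable \<B>" "topological_basis \<B>"
      using ex_countable_basis by blast
    have "\<exists>B\<in>\<B>. z \<in> B \<and> (\<forall>w\<in>B. u w = u z)" if z: "z \<notin> A" for z
    proof -
      obtain r where r: "r > 0" "\<forall>w\<in>ball z r. u w = u z"
        using const[OF z] by blast
      have "z \<in> ball z r"
        using r(1) by simp
      then obtain B where "B \<in> \<B>" "z \<in> B" "B \<subseteq> ball z r"
        by (rule topological_basisE[OF \<B>(2) open_ball])
      then show ?thesis
        using r(2) by blast
    qed
    then obtain B where B: "\<And>z. z \<notin> A \<Longrightarrow> B z \<in> \<B> \<and> z \<in> B z \<and> (\<forall>w\<in>B z. u w = u z)"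
      by metis
    have "countable (B ` (- A))"
      using B by (intro countable_subset[OF _ \<B>(1)]) auto
    moreover have "u ` (- A) \<subseteq> (\<lambda>b. u (SOME w. w \<in> b)) ` B ` (- A)"
    proof (rule image_subsetI)
      fix z assume "z \<in> - A"
      then have z: "z \<in> B z" "\<forall>w\<in>B z. u w = u z"
        using B[of z] by blast+
      have "(SOME w. w \<in> B z) \<in> B z"
        using z(1) by (rule someI[of "\<lambda>w. w \<in> B z"])
      then have "u (SOME w. w \<in> B z) = u z"
        using z(2) by blast
      then show "u z \<in> (\<lambda>b. u (SOME w. w \<in> b)) ` B ` (- A)"
        using \<open>z \<in> - A\<close> by (intro image_eqI[of _ _ "B z"] imageI) (rule sym)
    qed
    ultimately show ?thesis
      by (meson countable_image countable_subset)
  qed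
  then have "range (from_nat_into (insert 0 (u ` (- A)))) = insert 0 (u ` (- A))"
    by (intro range_from_nat_into) auto
  then obtain s :: "nat \<Rightarrow> real" where s: "u ` (- A) \<subseteq> range s"
    by blast
  define B where "B = (\<lambda>N. A \<union> {z. u z \<notin> s ` {..<N}})"
  have [measurable]: "B N \<in> sets borel" for N
  proof -
    have "open (u -` (- s ` {..<N}))"
      by (intro open_vimage[OF _ u] open_Compl finite_imp_closed) simp
    moreover have "{z. u z \<notin> s ` {..<N}} = u -` (- s ` {..<N})"
      by auto
    ultimately show ?thesis
      unfolding B_def by simp
  qed
  have bound: "I * ennreal W \<le> ennreal \<Lambda> * emeasure \<mu> (B N)" for N
  proof -
    \<comment> \<open>The strips as one set in the product of the parameter line and the space, for Tonelli.\<close>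
    define g where "g = (\<lambda>n t z. indicator {p :: real \<times> 'a. fst p < u (snd p) \<and>
        u (snd p) \<le> fst p + \<Lambda> / real (Suc n) \<and> snd p \<in> B N \<and> 0 < fst p \<and> fst p < W} (t, z) :: ennreal)"
    have g_meas [measurable]: "case_prod (g n) \<in> borel_measurable (lborel \<Otimes>\<^sub>M \<mu>)" for n
      unfolding g_def by measurable
    define f where "f = (\<lambda>n t. ennreal (real (Suc n)) * (\<integral>\<^sup>+ z. g n t z \<partial>\<mu>))"
    have [measurable]: "f n \<in> borel_measurable lborel" for n
      unfolding f_def by measurable
    have f_eq: "f n t = ennreal (real (Suc n)) * emeasure \<mu> ({z. t < u z \<and> u z \<le> t + \<Lambda> / real (Suc n)} \<inter> B N)"
      if "0 < t" "t < W" for n t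
    proof -
      have "(\<integral>\<^sup>+ z. g n t z \<partial>\<mu>) = (\<integral>\<^sup>+ z. indicator ({z. t < u z \<and> u z \<le> t + \<Lambda> / real (Suc n)} \<inter> B N) z \<partial>\<mu>)"
        unfolding g_def using that by (intro nn_integral_cong) (auto simp: indicator_def)
      also have "\<dots> = emeasure \<mu> ({z. t < u z \<and> u z \<le> t + \<Lambda> / real (Suc n)} \<inter> B N)"
        by (rule nn_integral_indicator) (simp, measurable)
      finally show ?thesis
        by (simp add: f_def)
    qed
    have int_f: "(\<integral>\<^sup>+ t. f n t \<partial>lborel) \<le> ennreal \<Lambda> * emeasure \<mu> (B N)" for n
    proof -
      have "(\<integral>\<^sup>+ t. \<integral>\<^sup>+ z. g n t z \<partial>\<mu> \<partial>lborel) = (\<integral>\<^sup>+ z. \<integral>\<^sup>+ t. g n t z \<partial>lborel \<partial>\<mu>)"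
        by (rule Fubini'[symmetric, OF g_meas])
      also have "\<dots> \<le> (\<integral>\<^sup>+ z. ennreal (\<Lambda> / real (Suc n)) * indicator (B N) z \<partial>\<mu>)"
      proof (rule nn_integral_mono)
        fix z
        have "(\<integral>\<^sup>+ t. g n t z \<partial>lborel) \<le> (\<integral>\<^sup>+ t. indicator (B N) z * indicator {u z - \<Lambda> / real (Suc n)..u z} t \<partial>lborel)"
          unfolding g_def by (intro nn_integral_mono) (auto simp: indicator_def)
        also have "\<dots> = indicator (B N) z * ennreal (\<Lambda> / real (Suc n))"
          using \<open>0 < \<Lambda>\<close> by (simp add: nn_integral_cmult_indicator)
        finally show "(\<integral>\<^sup>+ t. g n t z \<partial>lborel) \<le> ennreal (\<Lambda> / real (Suc n)) * indicator (B N) z"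
          by (simp add: mult.commute)
      qed
      also have "\<dots> = ennreal (\<Lambda> / real (Suc n)) * emeasure \<mu> (B N)"
        by (rule nn_integral_cmult_indicator) simp
      finally have "ennreal (real (Suc n)) * (\<integral>\<^sup>+ t. \<integral>\<^sup>+ z. g n t z \<partial>\<mu> \<partial>lborel)
          \<le> ennreal (real (Suc n)) * (ennreal (\<Lambda> / real (Suc n)) * emeasure \<mu> (B N))"
        by (rule mult_left_mono) simp
      also have "\<dots> = ennreal \<Lambda> * emeasure \<mu> (B N)"
        using \<open>0 < \<Lambda>\<close> by (simp add: mult.assoc[symmetric] ennreal_mult'[symmetric] del: of_nat_Suc)
      finally show ?thesis
        unfolding f_def by (subst nn_integral_cmult) measurable
    qed
    have "I \<le> liminf (\<lambda>n. f n t)" if t: "0 < t" "t < W" "t \<notin> s ` {..<N}" for t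
    proof -
      obtain d where d: "d > 0" "\<forall>v\<in>s ` {..<N}. v \<noteq> t \<longrightarrow> d \<le> dist t v"
        using finite_set_avoid[of "s ` {..<N}" t] by auto
      have "\<forall>\<^sub>F n in sequentially. \<Lambda> / real (Suc n) < d"
        using LIMSEQ_Suc[OF lim_const_over_n[of \<Lambda>]] d(1) by (intro order_tendstoD(2)[where y=0]) auto
      then have "\<forall>\<^sub>F n in sequentially. ennreal (real (Suc n)) * emeasure \<mu> {z. t < u z \<and> u z \<le> t + \<Lambda> / real (Suc n)} = f n t"
      proof eventually_elim
        case (elim n)
        have "z \<in> B N" if "t < u z" "u z \<le> t + \<Lambda> / real (Suc n)" for z
        proof -
          have "u z \<notin> s ` {..<N}"
            using d(2) that elim by (force simp: dist_real_def)
          then show ?thesis by (simp add: B_def)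
        qed
        then have "{z. t < u z \<and> u z \<le> t + \<Lambda> / real (Suc n)} \<inter> B N = {z. t < u z \<and> u z \<le> t + \<Lambda> / real (Suc n)}"
          by auto
        then show ?case
          using t by (simp add: f_eq)
      qed
      then show ?thesis
        using I[OF t(1,2)] Liminf_eq by fastforce
    qed
    moreover have "AE t in lborel. t \<notin> s ` {..<N}"
      by (intro AE_not_in) (simp add: countable_imp_null_set_lborel)
    ultimately have "AE t in lborel. I * indicator {0<..<W} t \<le> liminf (\<lambda>n. f n t)"
      by (auto elim!: eventually_mono simp: indicator_def)
    then have "(\<integral>\<^sup>+ t. I * indicator {0<..<W} t \<partial>lborel) \<le> (\<integral>\<^sup>+ t. liminf (\<lambda>n. f n t) \<partial>lborel)"
      by (rule nn_integral_mono_AE)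
    also have "\<dots> \<le> liminf (\<lambda>n. \<integral>\<^sup>+ t. f n t \<partial>lborel)"
      by (rule nn_integral_liminf) measurable
    also have "\<dots> \<le> liminf (\<lambda>n. ennreal \<Lambda> * emeasure \<mu> (B N))"
      by (intro Liminf_mono always_eventually allI int_f)
    also have "\<dots> = ennreal \<Lambda> * emeasure \<mu> (B N)"
      by (simp add: Liminf_const)
    finally show ?thesis
      using \<open>0 < W\<close> by (simp add: nn_integral_cmult_indicator)
  qed
  have "(\<lambda>N. emeasure \<mu> (B N)) \<longlonglongrightarrow> emeasure \<mu> (\<Inter>N. B N)"
  proof (rule Lim_emeasure_decseq)
    show "decseq B"
      by (auto simp: decseq_def B_def)
    show "emeasure \<mu> (B N) \<noteq> \<infinity>" for N
      using \<mu>.emeasure_finite by simp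
  qed auto
  moreover have "(\<Inter>N. B N) = A"
  proof -
    have "z \<in> A" if "\<And>N. z \<in> B N" for z
    proof (rule ccontr)
      assume "z \<notin> A"
      then obtain k where "u z = s k"
        using s by blast
      then show False
        using that[of "Suc k"] \<open>z \<notin> A\<close> by (auto simp: B_def)
    qed
    then show ?thesis
      by (auto simp: B_def)
  qed
  ultimately have "(\<lambda>N. ennreal \<Lambda> * emeasure \<mu> (B N)) \<longlonglongrightarrow> ennreal \<Lambda> * emeasure \<mu> A"
    by (intro ennreal_tendsto_cmult) auto
  then show ?thesis
    by (rule LIMSEQ_le_const) (use bound in blast)
qed


text \<open>
  A point at distance at most \<open>h\<close> from the sublevel set \<open>{u \<le> t}\<close> satisfies \<open>u \<le> t + \<Lambda> h\<close>, provided that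
  \<open>h < e\<close> and that the point lies in the region carrying the Riesz measure. The lower limit over all
  radii is at most the one along \<open>h = 1 / Suc n\<close>.
\<close>

lemma minkowski_content_le_strip:
  fixes m :: "'a::polish_space measure" and u :: "'a \<Rightarrow> real"
  assumes m: "metric_measure_space m" and "0 < e" "0 < \<Lambda>" and u: "continuous_on UNIV u"
    and lip: "\<And>z w. z \<in> riesz_region L x y \<Longrightarrow> dist z w < e \<Longrightarrow> u z \<le> u w + \<Lambda> * dist z w"
  shows "minkowski_content (riesz_measure m L x y) {z. u z \<le> t}
    \<le> liminf (\<lambda>n. ennreal (real (Suc n)) *
        emeasure (riesz_measure m L x y) {z. t < u z \<and> u z \<le> t + \<Lambda> / real (Suc n)})"
proof -
  let ?\<mu> = "riesz_measure m L x y"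
  let ?\<Omega> = "{z. u z \<le> t}"
  let ?F = "\<lambda>r. emeasure ?\<mu> (closed_nbhd r ?\<Omega> - ?\<Omega>) / ennreal r"
  note [simp] = riesz_measure_sets[OF m]
  have [measurable]: "u \<in> borel_measurable borel"
    by (rule borel_measurable_continuous_onI[OF u])
  have step: "?F (1 / real (Suc n)) \<le> ennreal (real (Suc n)) * emeasure ?\<mu> {z. t < u z \<and> u z \<le> t + \<Lambda> / real (Suc n)}"
    if n: "1 / real (Suc n) < e" for n
  proof -
    define h where "h = 1 / real (Suc n)"
    have h: "0 < h" "h < e"
      using n by (simp_all add: h_def)
    let ?S = "{z. t < u z \<and> u z \<le> t + \<Lambda> * h}"
    have "u z \<le> t + \<Lambda> * h" if z: "z \<in> closed_nbhd h ?\<Omega>" "z \<in> riesz_region L x y" for z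
    proof (rule field_le_epsilon)
      fix \<eta> :: real assume "\<eta> > 0"
      \<comment> \<open>The infimum in \<open>infdist\<close> is only approximated, up to \<open>\<eta> / \<Lambda>\<close> and within the range of \<open>lip\<close>.\<close>
      define h' where "h' = min e (h + \<eta> / \<Lambda>)"
      have "h < h'"
        using h \<open>\<eta> > 0\<close> \<open>0 < \<Lambda>\<close> by (simp add: h'_def)
      have ne: "?\<Omega> \<noteq> {}" and "infdist z ?\<Omega> \<le> h"
        using z by (auto simp: closed_nbhd_def)
      then have "(INF w\<in>?\<Omega>. dist z w) < h'"
        using \<open>h < h'\<close> by (simp add: infdist_notempty[OF ne])
      then obtain w where w: "u w \<le> t" "dist z w < h'"
        using ne by (subst (asm) cInf_less_iff) auto
      have "u z \<le> u w + \<Lambda> * dist z w"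
        using w by (intro lip z(2)) (simp add: h'_def)
      also have "\<dots> \<le> t + \<Lambda> * (h + \<eta> / \<Lambda>)"
        using w \<open>0 < \<Lambda>\<close> by (intro add_mono mult_left_mono) (auto simp: h'_def)
      finally show "u z \<le> t + \<Lambda> * h + \<eta>"
        using \<open>0 < \<Lambda>\<close> by (simp add: distrib_left)
    qed
    then have "closed_nbhd h ?\<Omega> - ?\<Omega> \<subseteq> ?S \<union> - riesz_region L x y"
      by force
    then have "emeasure ?\<mu> (closed_nbhd h ?\<Omega> - ?\<Omega>) \<le> emeasure ?\<mu> (?S \<union> - riesz_region L x y)"
      by (rule emeasure_mono) (auto simp: riesz_region_def)
    also have "\<dots> \<le> emeasure ?\<mu> ?S + emeasure ?\<mu> (- riesz_region L x y)"
      by (rule emeasure_subadditive) (auto simp: riesz_region_def)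
    also have "\<dots> = emeasure ?\<mu> ?S"
      by (simp add: emeasure_riesz_measure_off_region[OF m])
    finally have "emeasure ?\<mu> (closed_nbhd h ?\<Omega> - ?\<Omega>) / ennreal h \<le> emeasure ?\<mu> ?S / ennreal h"
      by (rule divide_right_mono_ennreal)
    also have "\<dots> = ennreal (real (Suc n)) * emeasure ?\<mu> ?S"
      using h(1) by (simp add: divide_ennreal_def inverse_ennreal h_def mult.commute del: of_nat_Suc)
    finally show ?thesis
      by (simp add: h_def del: of_nat_Suc)
  qed
  have to0: "filterlim (\<lambda>n. 1 / real (Suc n)) (at_right 0) sequentially"
    unfolding filterlim_at
    using LIMSEQ_Suc[OF lim_const_over_n[of "1::real"]] by (auto simp del: of_nat_Suc)
  have "minkowski_content ?\<mu> ?\<Omega> \<le> liminf (\<lambda>n. ?F (1 / real (Suc n)))"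
    unfolding minkowski_content_def le_Liminf_iff
  proof (intro allI impI)
    fix c assume "c < Liminf (at_right 0) ?F"
    then have "\<forall>\<^sub>F r in at_right 0. c < ?F r"
      by (rule less_LiminfD)
    then show "\<forall>\<^sub>F n in sequentially. c < ?F (1 / real (Suc n))"
      using to0 by (rule eventually_compose_filterlim)
  qed
  also have "\<dots> \<le> liminf (\<lambda>n. ennreal (real (Suc n)) * emeasure ?\<mu> {z. t < u z \<and> u z \<le> t + \<Lambda> / real (Suc n)})"
  proof (rule Liminf_mono)
    have "\<forall>\<^sub>F n in sequentially. 1 / real (Suc n) < e"
      using LIMSEQ_Suc[OF lim_const_over_n[of "1::real"]] \<open>0 < e\<close> by (intro order_tendstoD(2)[where y=0]) auto
    then show "\<forall>\<^sub>F n in sequentially. ?F (1 / real (Suc n))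
        \<le> ennreal (real (Suc n)) * emeasure ?\<mu> {z. t < u z \<and> u z \<le> t + \<Lambda> / real (Suc n)}"
      by eventually_elim (rule step)
  qed
  finally show ?thesis .
qed

text \<open>
  Apply the coarea inequality to \<open>u z = width x z A\<close>. All sublevel sets \<open>{u \<le> t}\<close> with
  \<open>0 < t < width x y A\<close> are competitors in \<^const>\<open>SS_top\<close>, so the infimum \<open>I\<close> of the Minkowski contents
  bounds each of their strips from below, and integration over \<open>t\<close> gives
  \<open>I * width x y A \<le> \<Lambda> * \<mu> A\<close>. The scale on which \<open>u\<close> is \<open>\<Lambda>\<close>-Lipschitz may depend on the point;
  compactness of balls makes it uniform on the region that carries the Riesz measure.
\<close>

lemma INF_minkowski_content_le_separating_ratio:
  fixes m :: "'a::polish_space measure" and x y :: 'a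
  assumes m: "metric_measure_space m" and dbl: "doubling m"
    and conn: "connected (UNIV :: 'a set)" and "L \<ge> 1" "\<Lambda> \<ge> 1"
    and qc: "locally_quasiconvex \<Lambda> TYPE('a)" and "x \<noteq> y" and A: "closed A"
  shows "ennreal (inverse \<Lambda>) * (INF \<Omega>\<in>SS_top x y. minkowski_content (riesz_measure m L x y) \<Omega>)
    \<le> separating_ratio m L x y A"
proof (cases "width x y A = 0")
  case True
  then show ?thesis
    by (simp add: separating_ratio_def)
next
  case False
  let ?\<mu> = "riesz_measure m L x y"
  define I where "I = (INF \<Omega>\<in>SS_top x y. minkowski_content ?\<mu> \<Omega>)"
  have A' [measurable]: "A \<in> sets borel"
    using A by simp
  define u where "u = (\<lambda>z. enn2real (width x z A))"
  have fin: "width x z A < \<infinity>" for z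
    by (rule width_finite[OF qc \<open>\<Lambda> \<ge> 1\<close> conn A'])
  have width_eq: "width x z A = ennreal (u z)" and u0: "0 \<le> u z" for z
    using fin[of z] by (simp_all add: u_def)
  have "u x = 0"
    by (simp add: u_def)
  have u_le: "u b \<le> u a + \<Lambda> * dist a b" if ab: "\<exists>\<gamma>. \<gamma> \<in> curves_const \<Lambda> a b" for a b
  proof -
    obtain \<gamma> where \<gamma>: "\<gamma> \<in> curves_const \<Lambda> a b"
      using ab by blast
    have "ennreal (u b) \<le> ennreal (u a) + ennreal (\<Lambda> * dist a b)"
      using width_le_add_dist[OF \<gamma> \<open>\<Lambda> \<ge> 1\<close> A', of x] unfolding width_eq .
    then show ?thesis
      using u0 \<open>\<Lambda> \<ge> 1\<close> by (simp flip: ennreal_plus)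
  qed
  have cont: "continuous_on UNIV u"
    unfolding continuous_on_iff
  proof (intro ballI allI impI)
    fix z :: 'a and e :: real assume "e > 0"
    obtain r where r: "r > 0" "\<And>a b. a \<in> ball z r \<Longrightarrow> b \<in> ball z r \<Longrightarrow> \<exists>\<gamma>. \<gamma> \<in> curves_const \<Lambda> a b"
      using locally_quasiconvexE[OF qc, of z] by blast
    have "dist (u w) (u z) < e" if "dist w z < min r (e / \<Lambda>)" for w
    proof -
      have "\<Lambda> * dist w z < e"
        using that \<open>\<Lambda> \<ge> 1\<close> by (simp add: pos_less_divide_eq mult.commute)
      moreover have "u w \<le> u z + \<Lambda> * dist z w" "u z \<le> u w + \<Lambda> * dist w z"
        using u_le[OF r(2)[of z w]] u_le[OF r(2)[of w z]] that r(1) by (auto simp: dist_commute)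
      ultimately show ?thesis
        by (simp add: dist_real_def dist_commute abs_less_iff)
    qed
    then show "\<exists>d>0. \<forall>w\<in>UNIV. dist w z < d \<longrightarrow> dist (u w) (u z) < e"
      using r(1) \<open>e > 0\<close> \<open>\<Lambda> \<ge> 1\<close> by (intro exI[of _ "min r (e / \<Lambda>)"]) auto
  qed
  define W where "W = u y"
  have "W > 0"
    using False u0[of y] by (simp add: W_def width_eq less_le)
  define G :: "'a set set" where "G = {B. \<exists>z r. B = ball z r \<and> (\<forall>a\<in>B. \<forall>b\<in>B. \<exists>\<gamma>. \<gamma> \<in> curves_const \<Lambda> a b)}"
  have "cball x ((2 * L + 1) * dist x y) \<subseteq> \<Union>G"
  proof
    fix z :: 'a
    obtain r where r: "r > 0" "\<And>a b. a \<in> ball z r \<Longrightarrow> b \<in> ball z r \<Longrightarrow> \<exists>\<gamma>. \<gamma> \<in> curves_const \<Lambda> a b"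
      using locally_quasiconvexE[OF qc, of z] by blast
    then have "ball z r \<in> G" "z \<in> ball z r"
      unfolding G_def by auto
    then show "z \<in> \<Union>G" by blast
  qed
  moreover have "open B" if "B \<in> G" for B
    using that by (auto simp: G_def)
  ultimately obtain e where e: "e > 0" "\<And>z. z \<in> cball x ((2 * L + 1) * dist x y) \<Longrightarrow> \<exists>B\<in>G. ball z e \<subseteq> B"
    using Heine_Borel_lemma[OF doubling_imp_compact_cball[OF m dbl]] by blast
  have lip: "u z \<le> u w + \<Lambda> * dist z w" if "z \<in> riesz_region L x y" "dist z w < e" for z w
  proof -
    have "z \<in> cball x ((2 * L + 1) * dist x y)"
      using riesz_region_subset(1)[OF \<open>L \<ge> 1\<close>, of x y] that(1) by auto
    then obtain B where B: "B \<in> G" "ball z e \<subseteq> B"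
      using e(2) by blast
    then have "z \<in> B" "w \<in> B"
      using e(1) that(2) by auto
    then show ?thesis
      using u_le[of w z] B(1) by (auto simp: G_def dist_commute)
  qed
  have "I * ennreal W \<le> ennreal \<Lambda> * emeasure ?\<mu> A"
  proof (rule coarea_inequality[OF _ _ cont A])
    show "sets ?\<mu> = sets borel"
      by (rule riesz_measure_sets[OF m])
    show "emeasure ?\<mu> UNIV < \<infinity>"
      by (rule emeasure_riesz_measure_finite[OF m dbl \<open>L \<ge> 1\<close> \<open>x \<noteq> y\<close>])
    show "\<exists>r>0. \<forall>w\<in>ball z r. u w = u z" if "z \<notin> A" for z
      using width_locally_const[OF qc \<open>\<Lambda> \<ge> 1\<close> A that, of x] unfolding u_def by metis
    show "0 < \<Lambda>" "0 < W"
      using \<open>\<Lambda> \<ge> 1\<close> \<open>W > 0\<close> by auto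
    fix t assume t: "0 < t" "t < W"
    have "open {z. u z < t}" "open {z. t < u z}" and closed: "closed {z. u z \<le> t}"
      by (intro open_Collect_less closed_Collect_le cont continuous_intros)+
    moreover have "x \<in> {z. u z < t}" "y \<in> {z. t < u z}"
      using t \<open>u x = 0\<close> by (auto simp: W_def)
    ultimately obtain r1 r2 where r: "r1 > 0" "ball x r1 \<subseteq> {z. u z < t}" "r2 > 0" "ball y r2 \<subseteq> {z. t < u z}"
      by (meson openE)
    have "ball x (min r1 r2) \<subseteq> interior {z. u z \<le> t}"
      using r by (intro interior_maximal) (auto simp: subset_iff less_imp_le)
    moreover have "ball y (min r1 r2) \<subseteq> - {z. u z \<le> t}"
      using r by (auto simp: subset_iff not_le)
    ultimately have "{z. u z \<le> t} \<in> SS_top x y"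
      using closed r unfolding SS_top_def by (intro CollectI conjI exI[of _ "min r1 r2"]) auto
    then have "I \<le> minkowski_content ?\<mu> {z. u z \<le> t}"
      unfolding I_def by (rule INF_lower)
    also have "\<dots> \<le> liminf (\<lambda>n. ennreal (real (Suc n)) * emeasure ?\<mu> {z. t < u z \<and> u z \<le> t + \<Lambda> / real (Suc n)})"
      using \<open>\<Lambda> \<ge> 1\<close> by (intro minkowski_content_le_strip[OF m e(1) _ cont lip]) auto
    finally show "I \<le> liminf (\<lambda>n. ennreal (real (Suc n)) * emeasure ?\<mu> {z. t < u z \<and> u z \<le> t + \<Lambda> / real (Suc n)})" .
  qed
  then have "ennreal (inverse \<Lambda>) * (I * ennreal W) \<le> ennreal (inverse \<Lambda>) * (ennreal \<Lambda> * emeasure ?\<mu> A)"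
    by (rule mult_left_mono) simp
  also have "\<dots> = emeasure ?\<mu> A"
    using \<open>\<Lambda> \<ge> 1\<close> by (simp add: mult.assoc[symmetric] ennreal_mult'[symmetric])
  finally have "ennreal (inverse \<Lambda>) * I * ennreal W / ennreal W \<le> emeasure ?\<mu> A / ennreal W"
    by (intro divide_right_mono_ennreal) (simp add: mult.assoc)
  also have "ennreal (inverse \<Lambda>) * I * ennreal W / ennreal W = ennreal (inverse \<Lambda>) * I"
    using \<open>W > 0\<close> by (simp add: mult_divide_eq_ennreal)
  finally show ?thesis
    using False fin[of y] by (simp add: separating_ratio_def I_def W_def width_eq)
qed

text \<open>
  If \<open>x = y\<close>, the constant curve has length \<open>0\<close>, so the ratio is infinite for every set, and
  no set separates \<open>x\<close> from itself, so that the infimum over \<^const>\<open>SS_top\<close> is infinite too.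
\<close>

lemma separating_ratio_refl: "separating_ratio m L x x A = \<infinity>"
  by (simp add: separating_ratio_def)

theorem theorem1p6:
  fixes m :: "'a::polish_space measure"
    and x y :: 'a
    and L :: real
  assumes "metric_measure_space m"
    and "doubling m"
    and "path_connected (UNIV :: 'a set)"
    and "L \<ge> 1"
  shows "(\<forall>\<Lambda>::real. \<Lambda> \<ge> 1 \<longrightarrow> locally_quasiconvex \<Lambda> TYPE('a) \<longrightarrow>
            ennreal (inverse \<Lambda>) * (INF \<Omega>\<in>SS_top x y. minkowski_content (riesz_measure m L x y) \<Omega>)
              \<le> (INF A\<in>{A. closed A}. separating_ratio m L x y A) \<and>
            (INF A\<in>{A. closed A}. separating_ratio m L x y A)
              \<le> (INF \<Omega>\<in>SS_top x y. minkowski_content (riesz_measure m L x y) \<Omega>))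
       \<and> (locally_geodesic TYPE('a) \<longrightarrow>
            (INF A\<in>{A. closed A}. separating_ratio m L x y A)
              = (INF \<Omega>\<in>SS_top x y. minkowski_content (riesz_measure m L x y) \<Omega>))"
proof -
  let ?content = "INF \<Omega>\<in>SS_top x y. minkowski_content (riesz_measure m L x y) \<Omega>"
  let ?ratio = "INF A\<in>{A. closed A}. separating_ratio m L x y A"
  have upper: "?ratio \<le> ?content"
    by (intro INF_greatest INF_separating_ratio_le_minkowski_content assms)
  have lower: "ennreal (inverse \<Lambda>) * ?content \<le> ?ratio"
    if "\<Lambda> \<ge> 1" "locally_quasiconvex \<Lambda> TYPE('a)" for \<Lambda>
  proof (rule INF_greatest)
    fix A :: "'a set" assume "A \<in> {A. closed A}"
    then show "ennreal (inverse \<Lambda>) * ?content \<le> separating_ratio m L x y A"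
      using INF_minkowski_content_le_separating_ratio[OF assms(1,2) path_connected_imp_connected[OF assms(3)] assms(4) that]
      by (cases "x = y") (auto simp: separating_ratio_refl)
  qed
  have "?ratio = ?content" if "locally_geodesic TYPE('a)"
    using upper lower[of 1] that by (intro antisym) (simp_all add: locally_geodesic_def)
  then show ?thesis
    using upper lower by blast
qed

end
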